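(* Let $r\ge 2$ be an integer and let $\delta,\epsilon$ be real numbers with $0<\delta<1$, $\epsilon>0$ and $\epsilon<\delta/(16r-16)$. There is a constant $M(\epsilon)$ depending only on $\epsilon$ such that for all sufficiently large $n$ there is a graph $G$ on $n$ vertices with the following property: if fewer than $\frac{n^2}{4(r-1)}(1-3\delta)(1-\epsilon)^2$ edge-deletions and edge-additions are performed on $G$, then the resulting graph contains an $(\epsilon,r,L,\delta)$-configuration with $L\ge n(1-\epsilon)/M(\epsilon)$.
   Context: For a graph and disjoint vertex sets $A,B$, the density is $d(A,B)=e(A,B)/(|A||B|)$, where $e(A,B)$ is the number of edges with one endpoint in $A$ and the other in $B$. A pair $(A,B)$ is $\epsilon$-regular if for all $X\subseteq A$, $Y\subseteq B$ with $|X|>\epsilon|A|$, $|Y|>\epsilon|B|$ we have $|d(X,Y)-d(A,B)|<\epsilon$. An $(\epsilon,r,L,\delta)$-configuration in a graph consists of pairwise disjoint vertex sets $V_1,\dots,V_r$ with $|V_1|=\dots=|V_r|=L$ such that for all $1\le i<j\le r$ the pair $(V_i,V_j)$ is $\epsilon$-regular and $d(V_i,V_j)\in(\delta,1-\delta)$. *)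

theory Defs
  imports Complex_Main "HOL-Library.Ramsey" "HOL-Library.Disjoint_Sets"
begin

definition simple_graph :: "'a set \<Rightarrow> 'a set set \<Rightarrow> bool" where
  "simple_graph V E \<longleftrightarrow> finite V \<and> E \<subseteq> [V]\<^bsup>2\<^esup>"

definition edges_between :: "'a set set \<Rightarrow> 'a set \<Rightarrow> 'a set \<Rightarrow> 'a set set" where
  "edges_between E A B = {e \<in> E. \<exists>a\<in>A. \<exists>b\<in>B. e = {a, b}}"

definition density :: "'a set set \<Rightarrow> 'a set \<Rightarrow> 'a set \<Rightarrow> real" where
  "density E A B = real (card (edges_between E A B)) / (real (card A) * real (card B))"

definition eps_regular :: "'a set set \<Rightarrow> real \<Rightarrow> 'a set \<Rightarrow> 'a set \<Rightarrow> bool" where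
  "eps_regular E \<epsilon> A B \<longleftrightarrow>
     (\<forall>X Y. X \<subseteq> A \<longrightarrow> Y \<subseteq> B \<longrightarrow>
        real (card X) > \<epsilon> * real (card A) \<longrightarrow> real (card Y) > \<epsilon> * real (card B) \<longrightarrow>
        \<bar>density E X Y - density E A B\<bar> < \<epsilon>)"

definition configuration ::
    "'a set \<Rightarrow> 'a set set \<Rightarrow> real \<Rightarrow> nat \<Rightarrow> nat \<Rightarrow> real \<Rightarrow> (nat \<Rightarrow> 'a set) \<Rightarrow> bool" where
  "configuration V E \<epsilon> r L \<delta> W \<longleftrightarrow>
     (\<forall>i\<in>{1..r}. W i \<subseteq> V \<and> card (W i) = L) \<and>
     disjoint_family_on W {1..r} \<and>
     (\<forall>i\<in>{1..r}. \<forall>j\<in>{1..r}. i < j \<longrightarrow>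
        eps_regular E \<epsilon> (W i) (W j) \<and> density E (W i) (W j) \<in> {\<delta><..<1 - \<delta>})"

end

theory Submission
  imports Defs "HOL-Analysis.Convex"
begin

text \<open>
  The graph \<open>G\<close> has subsets of \<open>{..<k}\<close> as vertices, joined when their intersection is even; by Lindsey's
  lemma all its large disjoint pairs have density close to 1/2. Apply Szemeredi's regularity lemma
  to the edited graph. If there is no configuration, then by Turan's theorem at least about a
  fraction \<open>1/(r - 1)\<close> of the pairs of parts are irregular or have density outside \<open>(\<delta>, 1 - \<delta>)\<close>. Few
  are irregular, and each pair with an extreme density costs about \<open>(1/2 - \<delta>) L\<^sup>2\<close> edits, which adds
  up to more edits than allowed.

  In the energy increment argument a partition is represented by a finite family \<open>\<F>\<close> of vertex
  sets: the parts are the classes of vertices lying in the same members of \<open>\<F>\<close>. At each stage the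
  parts are cut into blocks of one common size \<open>L\<close>, with a few vertices left over, and regularity is
  tested on the blocks only; adding the blocks and the irregularity witnesses to \<open>\<F>\<close> refines the
  partition, so the left-over vertices never cost energy.
\<close>

section \<open>Conditional expectation over a finite set\<close>

text \<open>The partition is given by the fibres of \<open>l\<close>. A point whose label is not
  attained on \<open>U\<close> gets 0 / 0 = 0, so bounds on \<open>cexp\<close> hold at every point
  and not only on \<open>U\<close>.\<close>

definition cexp :: "'u set \<Rightarrow> ('u \<Rightarrow> real) \<Rightarrow> ('u \<Rightarrow> 'l) \<Rightarrow> 'u \<Rightarrow> real" where
  "cexp U g l x = (\<Sum>y | y \<in> U \<and> l y = l x. g y) / real (card {y \<in> U. l y = l x})"

text \<open>Averaging over classes is self-adjoint and fixes functions of the label. Concretely,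
  after swapping the sums, each \<open>y\<close> passes its weight in equal shares to the members of
  its own class, and the shares add up to the whole.\<close>

lemma cexp_adjoint:
  assumes "finite U"
  shows "(\<Sum>x\<in>U. cexp U g l x * h (l x)) = (\<Sum>x\<in>U. g x * h (l x))"
proof -
  let ?c = "\<lambda>x. real (card {y \<in> U. l y = l x})"
  have "(\<Sum>x\<in>U. cexp U g l x * h (l x))
      = (\<Sum>x\<in>U. \<Sum>y\<in>U. if l y = l x then g y * h (l y) / ?c y else 0)"
  proof (rule sum.cong[OF refl])
    fix x
    have "cexp U g l x * h (l x) = (\<Sum>y | y \<in> U \<and> l y = l x. g y * h (l y) / ?c y)"
      unfolding cexp_def sum_divide_distrib sum_distrib_right by (rule sum.cong) auto
    then show "cexp U g l x * h (l x) = (\<Sum>y\<in>U. if l y = l x then g y * h (l y) / ?c y else 0)"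
      using assms by (simp only: sum.inter_filter)
  qed
  also have "\<dots> = (\<Sum>y\<in>U. \<Sum>x\<in>U. if l y = l x then g y * h (l y) / ?c y else 0)"
    by (rule sum.swap)
  also have "\<dots> = (\<Sum>y\<in>U. g y * h (l y))"
  proof (rule sum.cong[OF refl])
    fix y assume y: "y \<in> U"
    have "(\<Sum>x\<in>U. if l y = l x then g y * h (l y) / ?c y else 0)
        = (\<Sum>x | x \<in> U \<and> l y = l x. g y * h (l y) / ?c y)"
      using assms by (simp only: sum.inter_filter)
    also have "\<dots> = ?c y * (g y * h (l y) / ?c y)"
      by (simp add: eq_commute[of "l y"])
    also have "?c y \<noteq> 0"
      using y assms by auto
    then have "?c y * (g y * h (l y) / ?c y) = g y * h (l y)"
      by simp
    finally show "(\<Sum>x\<in>U. if l y = l x then g y * h (l y) / ?c y else 0) = g y * h (l y)" .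
  qed
  finally show ?thesis .
qed

text \<open>\<open>T\<close> is a union of classes, so its indicator is a function of the label and
  \<open>cexp_adjoint\<close> applies to it.\<close>

lemma sum_cexp_saturated:
  assumes "finite U" "T \<subseteq> U" and sat: "\<And>x. x \<in> U \<Longrightarrow> x \<in> T \<longleftrightarrow> l x \<in> S"
  shows "sum (cexp U g l) T = sum g T"
proof -
  have "(\<Sum>x\<in>U. f x * of_bool (l x \<in> S)) = sum f T" for f :: "'a \<Rightarrow> real"
  proof -
    have "(\<Sum>x\<in>U. f x * of_bool (l x \<in> S)) = (\<Sum>x\<in>U. if x \<in> T then f x else 0)"
      by (rule sum.cong) (auto simp: sat)
    also have "\<dots> = sum f (U \<inter> T)"
      using assms(1) by (simp add: sum.inter_restrict)
    finally show ?thesis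
      using assms(2) by (simp add: Int_absorb1)
  qed
  then show ?thesis
    using cexp_adjoint[OF assms(1), of g l "\<lambda>t. of_bool (t \<in> S)"] by simp
qed

text \<open>Pythagoras: the coarse average is a function of the fine label, hence orthogonal to the
  difference of the two averages. Applying \<open>cexp_adjoint\<close> once for each labelling
  evaluates the mixed term.\<close>

lemma sum_cexp_refine:
  assumes "finite U" and finer: "\<And>x. x \<in> U \<Longrightarrow> l0 x = \<phi> (l x)"
  shows "(\<Sum>x\<in>U. (cexp U g l x)\<^sup>2)
       = (\<Sum>x\<in>U. (cexp U g l0 x)\<^sup>2) + (\<Sum>x\<in>U. (cexp U g l x - cexp U g l0 x)\<^sup>2)"
proof -
  define h where "h t = (\<Sum>y | y \<in> U \<and> l0 y = t. g y) / real (card {y \<in> U. l0 y = t})" for t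
  have c0: "cexp U g l0 x = h (l0 x)" for x
    by (simp add: cexp_def h_def)
  have "(\<Sum>x\<in>U. cexp U g l x * cexp U g l0 x) = (\<Sum>x\<in>U. cexp U g l x * (h \<circ> \<phi>) (l x))"
    by (rule sum.cong) (auto simp: c0 finer)
  also have "\<dots> = (\<Sum>x\<in>U. g x * (h \<circ> \<phi>) (l x))"
    by (rule cexp_adjoint[OF assms(1)])
  also have "\<dots> = (\<Sum>x\<in>U. g x * h (l0 x))"
    by (rule sum.cong) (auto simp: finer)
  also have "\<dots> = (\<Sum>x\<in>U. cexp U g l0 x * h (l0 x))"
    by (rule cexp_adjoint[OF assms(1), symmetric])
  finally have "(\<Sum>x\<in>U. cexp U g l x * cexp U g l0 x) = (\<Sum>x\<in>U. (cexp U g l0 x)\<^sup>2)"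
    by (simp add: c0 power2_eq_square)
  then show ?thesis
    by (simp add: power2_diff sum.distrib sum_subtractf mult.assoc flip: sum_distrib_left)
qed

lemma cexp_bounds:
  assumes "finite U" "\<And>x. x \<in> U \<Longrightarrow> 0 \<le> g x" "\<And>x. x \<in> U \<Longrightarrow> g x \<le> 1"
  shows "0 \<le> cexp U g l x" "cexp U g l x \<le> 1"
proof -
  show "0 \<le> cexp U g l x"
    unfolding cexp_def using assms by (intro divide_nonneg_nonneg sum_nonneg) auto
  have "(\<Sum>y | y \<in> U \<and> l y = l x. g y) \<le> (\<Sum>y | y \<in> U \<and> l y = l x. 1)"
    using assms by (intro sum_mono) auto
  then show "cexp U g l x \<le> 1"
    unfolding cexp_def by (auto simp: divide_le_eq_1 intro: order_trans less_imp_le)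
qed

section \<open>Combinatorial tools\<close>

text \<open>Orthogonality of two rows of the parity matrix. Toggling an element \<open>x\<close>
  that lies in exactly one of \<open>S\<close> and \<open>S'\<close> is an involution of
  \<open>Pow K\<close> that flips exactly one of the two signs, so the sum equals its own
  negative.\<close>

lemma sum_pow_minus_one_inter_eq_0:
  assumes "finite K" "S \<subseteq> K" "S' \<subseteq> K" "S \<noteq> S'"
  shows "(\<Sum>T\<in>Pow K. (-1) ^ card (S \<inter> T) * (-1) ^ card (S' \<inter> T) :: real) = 0" (is "sum ?f _ = 0")
proof -
  obtain x where x: "x \<in> S \<longleftrightarrow> x \<notin> S'" "x \<in> K"
    using assms by blast
  define tog where "tog T = (if x \<in> T then T - {x} else insert x T)" for T
  have tt: "tog (tog T) = T" for T
    by (auto simp: tog_def)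
  have bij: "bij_betw tog (Pow K) (Pow K)"
    by (rule bij_betw_byWitness[where f' = tog]) (use x in \<open>auto simp: tt tog_def split: if_splits\<close>)
  have ins: "?f (insert x T) = - ?f T" if "T \<subseteq> K" "x \<notin> T" for T
  proof -
    have fin: "finite (S \<inter> T)" "finite (S' \<inter> T)"
      using assms(1) that(1) by (auto intro: finite_subset)
    show ?thesis
      using x(1) that(2) fin by (cases "x \<in> S") (auto simp: Int_insert_right)
  qed
  have neg: "?f (tog T) = - ?f T" if "T \<subseteq> K" for T
  proof (cases "x \<in> T")
    case True
    then have "insert x (T - {x}) = T" "T - {x} \<subseteq> K"
      using that by auto
    with ins[of "T - {x}"] True show ?thesis
      by (simp add: tog_def)
  next
    case False
    with ins[of T] that show ?thesis by (simp add: tog_def)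
  qed
  have "sum ?f (Pow K) = (\<Sum>T\<in>Pow K. ?f (tog T))"
    by (rule sum.reindex_bij_betw[OF bij, symmetric])
  also have "\<dots> = (\<Sum>T\<in>Pow K. - ?f T)"
    by (rule sum.cong) (use neg in auto)
  also have "\<dots> = - sum ?f (Pow K)"
    by (rule sum_negf)
  finally show ?thesis by simp
qed

text \<open>The sets \<open>S\<close> and \<open>T\<close> index the rows and columns of a Sylvester-Hadamard matrix.\<close>

lemma Lindsey_inter_parity:
  assumes K: "finite K" and \<A>: "\<A> \<subseteq> Pow K" and \<B>: "\<B> \<subseteq> Pow K"
  shows "(\<Sum>S\<in>\<A>. \<Sum>T\<in>\<B>. (-1) ^ card (S \<inter> T) :: real)\<^sup>2 \<le> 2 ^ card K * real (card \<A>) * real (card \<B>)"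
proof -
  let ?h = "\<lambda>S T. (-1) ^ card (S \<inter> T) :: real"
  have fin: "finite (Pow K)" "finite \<A>" "finite \<B>"
    using K \<A> \<B> by (auto intro: finite_subset)
  have "(\<Sum>S\<in>\<A>. \<Sum>T\<in>\<B>. ?h S T)\<^sup>2 = (\<Sum>T\<in>\<B>. \<Sum>S\<in>\<A>. ?h S T)\<^sup>2"
    by (subst sum.swap) simp
  also have "\<dots> \<le> (\<Sum>T\<in>\<B>. (\<Sum>S\<in>\<A>. ?h S T)\<^sup>2) * real (card \<B>)"
    by (rule sum_squared_le_sum_of_squares)
  \<comment> \<open>Passing from the columns in \<open>\<B>\<close> to all columns only adds
    squares, and makes the sum over \<open>T\<close> complete, so that the orthogonality of rows
    kills all terms with \<open>S\<close> different from \<open>S'\<close>.\<close>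
  also have "\<dots> \<le> (\<Sum>T\<in>Pow K. (\<Sum>S\<in>\<A>. ?h S T)\<^sup>2) * real (card \<B>)"
    using fin \<B> by (intro mult_right_mono sum_mono2) auto
  also have "(\<Sum>T\<in>Pow K. (\<Sum>S\<in>\<A>. ?h S T)\<^sup>2) = (\<Sum>T\<in>Pow K. \<Sum>S\<in>\<A>. \<Sum>S'\<in>\<A>. ?h S T * ?h S' T)"
    by (simp add: power2_eq_square sum_product)
  also have "\<dots> = (\<Sum>S\<in>\<A>. \<Sum>S'\<in>\<A>. \<Sum>T\<in>Pow K. ?h S T * ?h S' T)"
    by (subst sum.swap, subst (2) sum.swap) (rule refl)
  also have "\<dots> = (\<Sum>S\<in>\<A>. \<Sum>S'\<in>\<A>. if S = S' then 2 ^ card K else 0)"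
  proof (intro sum.cong refl)
    fix S S' assume S: "S \<in> \<A>" "S' \<in> \<A>"
    show "(\<Sum>T\<in>Pow K. ?h S T * ?h S' T) = (if S = S' then 2 ^ card K else 0)"
    proof (cases "S = S'")
      case True
      then show ?thesis
        using K by (simp add: card_Pow flip: power_mult_distrib)
    next
      case False
      then show ?thesis
        using sum_pow_minus_one_inter_eq_0[OF K, of S S'] S \<A> by auto
    qed
  qed
  also have "\<dots> = 2 ^ card K * real (card \<A>)"
    using fin by simp
  finally show ?thesis .
qed

text \<open>Greedy choice: take \<open>v\<close> of least degree and delete its neighbourhood. The
  deleted vertices carry total weight at most 1, paid for by \<open>v\<close>, and the weights of
  the others can only grow. As \<open>R\<close> is reflexive on \<open>V\<close>, a degree counts
  the vertex itself, so the weight is the usual 1 / (d + 1).\<close>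

lemma Caro_Wei_independent_set:
  assumes "finite V" and refl: "\<And>x. x \<in> V \<Longrightarrow> R x x" and sym: "\<And>x y. R x y \<Longrightarrow> R y x"
  shows "\<exists>I\<subseteq>V. (\<forall>x\<in>I. \<forall>y\<in>I. x \<noteq> y \<longrightarrow> \<not> R x y)
    \<and> (\<Sum>v\<in>V. 1 / real (card {w\<in>V. R v w})) \<le> real (card I)"
  using assms(1,2)
proof (induction V rule: finite_psubset_induct)
  case (psubset V)
  show ?case
  proof (cases "V = {}")
    case False
    let ?d = "\<lambda>v. card {w\<in>V. R v w}"
    obtain v where v: "v \<in> V" "\<And>u. u \<in> V \<Longrightarrow> ?d v \<le> ?d u"
      using arg_min_if_finite(1)[OF psubset.hyps(1) False, of ?d] arg_min_least[OF psubset.hyps(1) False, of _ ?d]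
      by blast
    let ?N = "{w\<in>V. R v w}"
    let ?V = "V - ?N"
    have pos: "?d u > 0" if "u \<in> V" for u
      using that psubset by (auto simp: card_gt_0_iff)
    have "?V \<subset> V"
      using v(1) psubset.prems by auto
    from psubset.IH[OF this] obtain I where I: "I \<subseteq> ?V" "\<forall>x\<in>I. \<forall>y\<in>I. x \<noteq> y \<longrightarrow> \<not> R x y"
      "(\<Sum>u\<in>?V. 1 / real (card {w\<in>?V. R u w})) \<le> real (card I)"
      using psubset.prems by auto
    have "(\<Sum>u\<in>?V. 1 / real (?d u)) \<le> (\<Sum>u\<in>?V. 1 / real (card {w\<in>?V. R u w}))"
    proof (rule sum_mono)
      fix u assume u: "u \<in> ?V"
      then have "u \<in> {w\<in>?V. R u w}"
        using psubset.prems by auto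
      then have "card {w\<in>?V. R u w} > 0"
        using psubset.hyps(1) by (auto simp: card_gt_0_iff)
      moreover have "card {w\<in>?V. R u w} \<le> ?d u"
        using psubset.hyps(1) by (intro card_mono) auto
      ultimately show "1 / real (?d u) \<le> 1 / real (card {w\<in>?V. R u w})"
        by (intro divide_left_mono) auto
    qed
    moreover have "(\<Sum>u\<in>?N. 1 / real (?d u)) \<le> (\<Sum>u\<in>?N. 1 / real (?d v))"
      using v pos by (intro sum_mono divide_left_mono) auto
    moreover have "(\<Sum>u\<in>?N. 1 / real (?d v)) = 1"
      using pos[OF v(1)] by simp
    moreover have "(\<Sum>u\<in>V. 1 / real (?d u)) = (\<Sum>u\<in>?V. 1 / real (?d u)) + (\<Sum>u\<in>?N. 1 / real (?d u))"
      using psubset.hyps(1) by (intro sum.subset_diff) auto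
    moreover have "real (card (insert v I)) = 1 + real (card I)"
      using I(1) v(1) psubset finite_subset[OF I(1)] by (subst card_insert_disjoint) auto
    ultimately have "(\<Sum>u\<in>V. 1 / real (?d u)) \<le> real (card (insert v I))"
      using I(3) by linarith
    moreover have "\<forall>x\<in>insert v I. \<forall>y\<in>insert v I. x \<noteq> y \<longrightarrow> \<not> R x y"
      using I(1,2) sym by blast
    ultimately show ?thesis
      using I(1) v(1) by (intro exI[of _ "insert v I"]) auto
  qed auto
qed

text \<open>By Cauchy-Schwarz, |V|^2 is at most the sum of the degrees times the sum of their
  reciprocals. The first factor is the number of related ordered pairs, diagonal included, and
  Caro-Wei bounds the second by the size of an independent set.\<close>

lemma independent_set_Turan:
  assumes "finite V" and refl: "\<And>x. x \<in> V \<Longrightarrow> R x x" and sym: "\<And>x y. R x y \<Longrightarrow> R y x"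
    and few: "real s * real (card {(x, y) \<in> V \<times> V. R x y}) < (real (card V))\<^sup>2"
  shows "\<exists>I\<subseteq>V. card I = Suc s \<and> (\<forall>x\<in>I. \<forall>y\<in>I. x \<noteq> y \<longrightarrow> \<not> R x y)"
proof -
  let ?d = "\<lambda>v. real (card {w\<in>V. R v w})"
  obtain I where I: "I \<subseteq> V" "\<forall>x\<in>I. \<forall>y\<in>I. x \<noteq> y \<longrightarrow> \<not> R x y" "(\<Sum>v\<in>V. 1 / ?d v) \<le> real (card I)"
    using Caro_Wei_independent_set[of V R, OF assms(1) refl sym] by auto
  have pos: "?d v > 0" if "v \<in> V" for v
    using that assms by (auto simp: card_gt_0_iff)
  have "{(x, y) \<in> V \<times> V. R x y} = Sigma V (\<lambda>v. {w\<in>V. R v w})"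
    by auto
  then have cd: "real (card {(x, y) \<in> V \<times> V. R x y}) = (\<Sum>v\<in>V. ?d v)"
    using assms(1) by simp
  have "sqrt (?d v) * sqrt (1 / ?d v) = 1" if "v \<in> V" for v
    using pos[OF that] by (simp flip: real_sqrt_mult)
  then have "(real (card V))\<^sup>2 = (\<Sum>v\<in>V. sqrt (?d v) * sqrt (1 / ?d v))\<^sup>2"
    by simp
  also have "\<dots> \<le> (\<Sum>v\<in>V. (sqrt (?d v))\<^sup>2) * (\<Sum>v\<in>V. (sqrt (1 / ?d v))\<^sup>2)"
    by (rule Cauchy_Schwarz_ineq_sum)
  also have "\<dots> = (\<Sum>v\<in>V. ?d v) * (\<Sum>v\<in>V. 1 / ?d v)"
    by simp
  also have "\<dots> \<le> (\<Sum>v\<in>V. ?d v) * real (card I)"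
    using I(3) by (intro mult_left_mono sum_nonneg) auto
  finally have "real s * (\<Sum>v\<in>V. ?d v) < real (card I) * (\<Sum>v\<in>V. ?d v)"
    using few cd by (simp add: mult.commute)
  then have "Suc s \<le> card I"
    using mult_right_less_imp_less[of "real s" "\<Sum>v\<in>V. ?d v" "real (card I)"] by (simp add: sum_nonneg)
  then obtain J where "J \<subseteq> I" "card J = Suc s"
    by (metis obtain_subset_with_card_n)
  with I show ?thesis
    by (intro exI[of _ J]) blast
qed

lemma chunk_fibres:
  fixes f :: "'a \<Rightarrow> 'l"
  assumes "finite V" "L > 0"
  shows "\<exists>\<B>. finite \<B> \<and> disjoint \<B> \<and> \<Union>\<B> \<subseteq> V \<and> (\<forall>B\<in>\<B>. card B = L \<and> (\<forall>x\<in>B. \<forall>y\<in>B. f x = f y))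
    \<and> card (V - \<Union>\<B>) \<le> L * card (f ` V)"
  using assms(1)
proof (induction V rule: finite_psubset_induct)
  case (psubset V)
  show ?case
  proof (cases "\<exists>t. card {v\<in>V. f v = t} \<ge> L")
    case True
    then obtain t B where B: "B \<subseteq> {v\<in>V. f v = t}" "card B = L"
      by (metis obtain_subset_with_card_n)
    have "B \<noteq> {}"
      using B(2) assms(2) by auto
    then have "V - B \<subset> V"
      using B by auto
    from psubset.IH[OF this] obtain \<B> where \<B>: "finite \<B>" "disjoint \<B>" "\<Union>\<B> \<subseteq> V - B"
      "\<forall>B\<in>\<B>. card B = L \<and> (\<forall>x\<in>B. \<forall>y\<in>B. f x = f y)" "card (V - B - \<Union>\<B>) \<le> L * card (f ` (V - B))"
      by auto
    have "card (f ` (V - B)) \<le> card (f ` V)"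
      using psubset.hyps(1) by (intro card_mono) auto
    then have "card (V - B - \<Union>\<B>) \<le> L * card (f ` V)"
      using \<B>(5) by (meson le_trans mult_le_mono2)
    moreover have "V - \<Union>(insert B \<B>) = V - B - \<Union>\<B>"
      by auto
    moreover have "disjoint (insert B \<B>)"
      using \<B>(2,3) by (auto simp: disjoint_def)
    moreover have "finite (insert B \<B>)" "\<Union>(insert B \<B>) \<subseteq> V"
      using \<B>(1,3) B(1) by auto
    moreover have "\<forall>x\<in>B. \<forall>y\<in>B. f x = f y"
      using B(1) by (metis (mono_tags, lifting) mem_Collect_eq subsetD)
    then have "\<forall>B\<in>insert B \<B>. card B = L \<and> (\<forall>x\<in>B. \<forall>y\<in>B. f x = f y)"
      using \<B>(4) B(2) by blast
    ultimately show ?thesis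
      by metis
  next
    case False
    have "card V = (\<Sum>t\<in>f ` V. card {v\<in>V. f v = t})"
      using sum.group[OF psubset.hyps(1) finite_imageI[OF psubset.hyps(1)] order_refl, where h = "\<lambda>_. 1 :: nat" and g = f]
      by simp
    also have "\<dots> \<le> (\<Sum>t\<in>f ` V. L)"
      using False by (intro sum_mono) (meson nle_le)
    finally show ?thesis
      by (intro exI[of _ "{}"]) (auto simp: mult.commute)
  qed
qed

section \<open>Energy increment\<close>

lemma card_edges_between:
  assumes "X \<inter> Y = {}"
  shows "card (edges_between E X Y) = card {(a, b) \<in> X \<times> Y. {a, b} \<in> E}"
proof -
  have "bij_betw (\<lambda>(a, b). {a, b}) {(a, b) \<in> X \<times> Y. {a, b} \<in> E} (edges_between E X Y)"
    unfolding bij_betw_def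
  proof
    show "inj_on (\<lambda>(a, b). {a, b}) {(a, b) \<in> X \<times> Y. {a, b} \<in> E}"
      using assms by (auto simp: inj_on_def doubleton_eq_iff)
    show "(\<lambda>(a, b). {a, b}) ` {(a, b) \<in> X \<times> Y. {a, b} \<in> E} = edges_between E X Y"
      by (auto simp: edges_between_def image_def)
  qed
  then show ?thesis
    by (rule bij_betw_same_card[symmetric])
qed

definition adj :: "'a set set \<Rightarrow> 'a \<times> 'a \<Rightarrow> real" where
  "adj E = (\<lambda>(a, b). of_bool ({a, b} \<in> E))"

lemma adj_bounds: "0 \<le> adj E p" "adj E p \<le> 1"
  by (auto simp: adj_def split: prod.split)

lemma card_edges_between_sum_adj:
  assumes "finite X" "finite Y" "X \<inter> Y = {}"
  shows "real (card (edges_between E X Y)) = sum (adj E) (X \<times> Y)"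
proof -
  have "sum (adj E) (X \<times> Y) = (\<Sum>p\<in>X \<times> Y. if {fst p, snd p} \<in> E then 1 else 0)"
    by (rule sum.cong) (auto simp: adj_def)
  also have "\<dots> = real (card {p \<in> X \<times> Y. {fst p, snd p} \<in> E})"
    using assms by (simp flip: sum.inter_filter)
  also have "{p \<in> X \<times> Y. {fst p, snd p} \<in> E} = {(a, b) \<in> X \<times> Y. {a, b} \<in> E}"
    by auto
  finally show ?thesis
    using card_edges_between[OF assms(3)] by metis
qed

lemma edges_between_commute: "edges_between E X Y = edges_between E Y X"
  by (auto simp: edges_between_def insert_commute)

lemma density_commute: "density E X Y = density E Y X"
  by (simp add: density_def edges_between_commute[of E X] mult.commute)

lemma eps_regular_commute: "eps_regular E \<epsilon> X Y \<longleftrightarrow> eps_regular E \<epsilon> Y X"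
  unfolding eps_regular_def by (metis density_commute)

section \<open>Partitions generated by a family of sets, and their energy\<close>

definition membership :: "'a set set \<Rightarrow> 'a \<Rightarrow> 'a set set" where
  "membership \<F> v = {F \<in> \<F>. v \<in> F}"

definition membership2 :: "'a set set \<Rightarrow> 'a \<times> 'a \<Rightarrow> 'a set set \<times> 'a set set" where
  "membership2 \<F> = map_prod (membership \<F>) (membership \<F>)"

abbreviation block_average :: "'a set \<Rightarrow> 'a set set \<Rightarrow> 'a set set \<Rightarrow> 'a \<times> 'a \<Rightarrow> real" where
  "block_average V E \<F> \<equiv> cexp (V \<times> V) (adj E) (membership2 \<F>)"

text \<open>The usual index (mean square density) multiplied by |V|^2. Pairs inside one part are
  included, so that the energy is the squared norm of a single conditional expectation on
  \<open>V \<times> V\<close>.\<close>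

definition energy :: "'a set \<Rightarrow> 'a set set \<Rightarrow> 'a set set \<Rightarrow> real" where
  "energy V E \<F> = (\<Sum>p\<in>V \<times> V. (block_average V E \<F> p)\<^sup>2)"

lemma energy_nonneg: "energy V E \<F> \<ge> 0"
  by (simp add: energy_def sum_nonneg)

lemma energy_le:
  assumes "finite V"
  shows "energy V E \<F> \<le> (real (card V))\<^sup>2"
proof -
  have "energy V E \<F> \<le> (\<Sum>p\<in>V \<times> V. 1)"
    unfolding energy_def using assms
    by (intro sum_mono power_le_one cexp_bounds) (auto simp: adj_bounds)
  then show ?thesis
    by (simp add: power2_eq_square card_cartesian_product)
qed

lemma energy_refine:
  assumes "finite V" "\<F> \<subseteq> \<F>'"
  shows "energy V E \<F>' = energy V E \<F>
    + (\<Sum>p\<in>V \<times> V. (block_average V E \<F>' p - block_average V E \<F> p)\<^sup>2)"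
  unfolding energy_def
proof (rule sum_cexp_refine)
  \<comment> \<open>The coarse label is recovered from the fine one by forgetting the sets outside
    \<open>\<F>\<close>.\<close>
  show "membership2 \<F> p = map_prod (\<lambda>t. t \<inter> \<F>) (\<lambda>t. t \<inter> \<F>) (membership2 \<F>' p)" for p
    using assms(2) by (cases p) (auto simp: membership2_def membership_def)
qed (use assms in auto)

lemma energy_mono: "finite V \<Longrightarrow> \<F> \<subseteq> \<F>' \<Longrightarrow> energy V E \<F> \<le> energy V E \<F>'"
  by (simp add: energy_refine[of V \<F> \<F>' E] sum_nonneg)

lemma block_average_of_classes:
  assumes "finite V" "A \<subseteq> V" "B \<subseteq> V" "A \<inter> B = {}" "a \<in> A" "b \<in> B"
    and A: "\<And>v. v \<in> V \<Longrightarrow> membership \<F> v = membership \<F> a \<longleftrightarrow> v \<in> A"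
    and B: "\<And>v. v \<in> V \<Longrightarrow> membership \<F> v = membership \<F> b \<longleftrightarrow> v \<in> B"
  shows "block_average V E \<F> (a, b) = density E A B"
proof -
  have "{p \<in> V \<times> V. membership2 \<F> p = membership2 \<F> (a, b)}
      = {v \<in> V. membership \<F> v = membership \<F> a} \<times> {v \<in> V. membership \<F> v = membership \<F> b}"
    by (auto simp: membership2_def)
  also have "{v \<in> V. membership \<F> v = membership \<F> a} = A"
    using A assms(2) by blast
  also have "{v \<in> V. membership \<F> v = membership \<F> b} = B"
    using B assms(3) by blast
  finally have "{p \<in> V \<times> V. membership2 \<F> p = membership2 \<F> (a, b)} = A \<times> B" .
  moreover have "real (card (edges_between E A B)) = sum (adj E) (A \<times> B)"
    using assms(1-4) by (intro card_edges_between_sum_adj) (auto intro: finite_subset)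
  ultimately show ?thesis
    by (simp add: cexp_def density_def card_cartesian_product)
qed

text \<open>Since \<open>X\<close> and \<open>Y\<close> belong to the family,
  \<open>X \<times> Y\<close> is a union of classes of pairs, and averaging preserves its
  sum.\<close>

lemma sum_block_average:
  assumes "finite V" "X \<in> \<F>" "Y \<in> \<F>" "X \<subseteq> V" "Y \<subseteq> V" "X \<inter> Y = {}"
  shows "sum (block_average V E \<F>) (X \<times> Y) = real (card (edges_between E X Y))"
proof -
  have "sum (block_average V E \<F>) (X \<times> Y) = sum (adj E) (X \<times> Y)"
    by (rule sum_cexp_saturated[where S = "{(s, t). X \<in> s \<and> Y \<in> t}"])
      (use assms(1-5) in \<open>auto simp: membership2_def membership_def\<close>)
  also have "\<dots> = real (card (edges_between E X Y))"
    using assms by (intro card_edges_between_sum_adj[symmetric]) (auto intro: finite_subset)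
  finally show ?thesis .
qed

text \<open>On \<open>X \<times> Y\<close> the old average is the constant
  \<open>density E A B\<close>, while the new average has the true edge count as its sum. Hence the
  difference sums to |X||Y| times the gap between the densities, and Cauchy-Schwarz turns this into
  a bound on its squares.\<close>

lemma energy_increment_pair:
  assumes V: "finite V" and AB: "A \<subseteq> V" "B \<subseteq> V" "A \<inter> B = {}"
    and cls: "\<And>v w. v \<in> A \<Longrightarrow> w \<in> V \<Longrightarrow> membership \<F> w = membership \<F> v \<longleftrightarrow> w \<in> A"
      "\<And>v w. v \<in> B \<Longrightarrow> w \<in> V \<Longrightarrow> membership \<F> w = membership \<F> v \<longleftrightarrow> w \<in> B"
    and XY: "X \<subseteq> A" "Y \<subseteq> B" "X \<in> \<F>'" "Y \<in> \<F>'"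
  shows "real (card X) * real (card Y) * (density E X Y - density E A B)\<^sup>2
    \<le> (\<Sum>p\<in>X \<times> Y. (block_average V E \<F>' p - block_average V E \<F> p)\<^sup>2)"
proof (cases "card X * card Y = 0")
  case True
  then show ?thesis
    by (auto simp: sum_nonneg)
next
  case False
  let ?d = "\<lambda>p. block_average V E \<F>' p - block_average V E \<F> p"
  let ?c = "real (card X) * real (card Y)"
  have c: "?c > 0"
    using False by simp
  have XY': "X \<subseteq> V" "Y \<subseteq> V" "X \<inter> Y = {}"
    using XY(1,2) AB by auto
  have "sum ?d (X \<times> Y) = (\<Sum>p\<in>X \<times> Y. block_average V E \<F>' p - density E A B)"
  proof (rule sum.cong[OF refl])
    fix p assume "p \<in> X \<times> Y"
    then obtain a b where p: "p = (a, b)" "a \<in> A" "b \<in> B"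
      using XY(1,2) by blast
    then show "?d p = block_average V E \<F>' p - density E A B"
      using block_average_of_classes[OF V AB p(2,3) cls(1)[OF p(2)] cls(2)[OF p(3)]] by simp
  qed
  also have "\<dots> = real (card (edges_between E X Y)) - ?c * density E A B"
    using sum_block_average[OF V XY(3,4) XY'] by (simp add: sum_subtractf card_cartesian_product)
  also have "real (card (edges_between E X Y)) = ?c * density E X Y"
    using False by (simp add: density_def)
  finally have s: "sum ?d (X \<times> Y) = ?c * (density E X Y - density E A B)"
    by (simp add: algebra_simps)
  have "(sum ?d (X \<times> Y))\<^sup>2 \<le> (\<Sum>p\<in>X \<times> Y. (?d p)\<^sup>2) * ?c"
    using sum_squared_le_sum_of_squares[of ?d "X \<times> Y"] by (simp add: card_cartesian_product)
  then have "?c * (?c * (density E X Y - density E A B)\<^sup>2) \<le> ?c * (\<Sum>p\<in>X \<times> Y. (?d p)\<^sup>2)"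
    unfolding s by (simp add: power2_eq_square algebra_simps)
  then show ?thesis
    using c by (rule mult_left_le_imp_le)
qed

text \<open>Every irregular ordered pair has witnesses larger than \<epsilon>L whose density
  deviates by at least \<epsilon>, so it gains at least (\<epsilon>L)(\<epsilon>L)\<epsilon>^2. The
  rectangles spanned by the witnesses are disjoint for distinct pairs, so the gains add up.\<close>

lemma energy_increment:
  assumes V: "finite V" and \<F>: "finite \<F>" and \<epsilon>: "\<epsilon> > 0"
    and \<B>: "finite \<B>" "disjoint \<B>" "\<Union>\<B> \<subseteq> V"
      "\<And>B. B \<in> \<B> \<Longrightarrow> card B = L"
      "\<And>B x y. B \<in> \<B> \<Longrightarrow> x \<in> B \<Longrightarrow> y \<in> B \<Longrightarrow> membership \<F> x = membership \<F> y"
    and Irr: "Irr \<subseteq> \<B> \<times> \<B>" "\<And>A B. (A, B) \<in> Irr \<Longrightarrow> A \<noteq> B \<and> \<not> eps_regular E \<epsilon> A B"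
  shows "\<exists>\<F>'. finite \<F>' \<and> card \<F>' \<le> card \<F> + card \<B> + 2 * (card \<B>)\<^sup>2
    \<and> energy V E \<F> + real (card Irr) * (\<epsilon> ^ 4 * (real L)\<^sup>2) \<le> energy V E \<F>'"
proof -
  have "\<forall>p\<in>Irr. \<exists>X Y. X \<subseteq> fst p \<and> Y \<subseteq> snd p \<and> real (card X) > \<epsilon> * real L \<and> real (card Y) > \<epsilon> * real L
      \<and> \<bar>density E X Y - density E (fst p) (snd p)\<bar> \<ge> \<epsilon>"
  proof
    fix p assume p: "p \<in> Irr"
    then have "\<not> eps_regular E \<epsilon> (fst p) (snd p)" "fst p \<in> \<B>" "snd p \<in> \<B>"
      using Irr by (cases p; auto)+
    then show "\<exists>X Y. X \<subseteq> fst p \<and> Y \<subseteq> snd p \<and> real (card X) > \<epsilon> * real L \<and> real (card Y) > \<epsilon> * real L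
      \<and> \<bar>density E X Y - density E (fst p) (snd p)\<bar> \<ge> \<epsilon>"
      unfolding eps_regular_def using \<B>(4) by (metis not_less)
  qed
  then obtain X Y where XY: "\<And>p. p \<in> Irr \<Longrightarrow> X p \<subseteq> fst p" "\<And>p. p \<in> Irr \<Longrightarrow> Y p \<subseteq> snd p"
    "\<And>p. p \<in> Irr \<Longrightarrow> real (card (X p)) > \<epsilon> * real L" "\<And>p. p \<in> Irr \<Longrightarrow> real (card (Y p)) > \<epsilon> * real L"
    "\<And>p. p \<in> Irr \<Longrightarrow> \<bar>density E (X p) (Y p) - density E (fst p) (snd p)\<bar> \<ge> \<epsilon>"
    by metis
  have finI: "finite Irr"
    using Irr(1) \<B>(1) by (meson finite_SigmaI finite_subset)
  have cardI: "card Irr \<le> (card \<B>)\<^sup>2"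
    using card_mono[OF _ Irr(1)] \<B>(1) by (simp add: card_cartesian_product power2_eq_square)
  \<comment> \<open>The refinement has two stages: with \<open>\<F>1\<close> every block becomes a
    full class, as \<open>energy_increment_pair\<close> requires of the old partition;
    \<open>\<F>2\<close> then adds the witnesses. The first stage cannot lower the energy.\<close>
  define \<F>1 where "\<F>1 = \<F> \<union> \<B>"
  define \<F>2 where "\<F>2 = \<F>1 \<union> (X ` Irr \<union> Y ` Irr)"
  have fin2: "finite \<F>2"
    by (simp add: \<F>2_def \<F>1_def \<F> \<B>(1) finI)
  have "card \<F>2 \<le> card \<F> + card \<B> + (card (X ` Irr) + card (Y ` Irr))"
    unfolding \<F>2_def \<F>1_def by (meson add_mono card_Un_le le_trans)
  also have "\<dots> \<le> card \<F> + card \<B> + 2 * (card \<B>)\<^sup>2"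
    using card_image_le[OF finI, of X] card_image_le[OF finI, of Y] cardI by linarith
  finally have card2: "card \<F>2 \<le> card \<F> + card \<B> + 2 * (card \<B>)\<^sup>2" .
  have cls: "membership \<F>1 w = membership \<F>1 v \<longleftrightarrow> w \<in> B" if "B \<in> \<B>" "v \<in> B" "w \<in> V" for B v w
  proof
    assume "membership \<F>1 w = membership \<F>1 v"
    then show "w \<in> B"
      using that by (auto simp: membership_def \<F>1_def)
  next
    assume w: "w \<in> B"
    have "w \<in> B' \<longleftrightarrow> v \<in> B'" if "B' \<in> \<B>" for B'
      using that \<open>B \<in> \<B>\<close> \<open>v \<in> B\<close> w \<B>(2) by (auto simp: disjoint_def)
    moreover have "membership \<F> w = membership \<F> v"
      using \<B>(5) that w by blast
    ultimately show "membership \<F>1 w = membership \<F>1 v"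
      by (auto simp: membership_def \<F>1_def)
  qed
  let ?d = "\<lambda>p. (block_average V E \<F>2 p - block_average V E \<F>1 p)\<^sup>2"
  have pairs: "fst p \<in> \<B> \<and> snd p \<in> \<B> \<and> fst p \<inter> snd p = {}" if "p \<in> Irr" for p
  proof -
    have "fst p \<in> \<B>" "snd p \<in> \<B>" "fst p \<noteq> snd p"
      using Irr that by (cases p; auto)+
    then show ?thesis
      using \<B>(2) by (auto simp: disjoint_def)
  qed
  have sub: "X p \<subseteq> V" "Y p \<subseteq> V" if "p \<in> Irr" for p
    using pairs[OF that] XY(1,2)[OF that] \<B>(3) by auto
  have "real (card Irr) * (\<epsilon> ^ 4 * (real L)\<^sup>2) = (\<Sum>p\<in>Irr. \<epsilon> ^ 4 * (real L)\<^sup>2)"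
    by simp
  also have "\<dots> \<le> (\<Sum>p\<in>Irr. sum ?d (X p \<times> Y p))"
  proof (rule sum_mono)
    fix p assume p: "p \<in> Irr"
    have "\<epsilon> ^ 4 * (real L)\<^sup>2 = (\<epsilon> * real L) * (\<epsilon> * real L) * \<epsilon>\<^sup>2"
      by (simp add: power2_eq_square power4_eq_xxxx)
    also have "\<dots> \<le> real (card (X p)) * real (card (Y p)) * (density E (X p) (Y p) - density E (fst p) (snd p))\<^sup>2"
    proof (intro mult_mono)
      show "\<epsilon>\<^sup>2 \<le> (density E (X p) (Y p) - density E (fst p) (snd p))\<^sup>2"
        using XY(5)[OF p] \<epsilon> by (metis abs_le_square_iff abs_of_pos)
    qed (use XY(3,4)[OF p] \<epsilon> in auto)
    also have "\<dots> \<le> sum ?d (X p \<times> Y p)"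
    proof (rule energy_increment_pair[OF V])
      show "fst p \<subseteq> V" "snd p \<subseteq> V" "fst p \<inter> snd p = {}"
        using pairs[OF p] \<B>(3) by auto
      show "membership \<F>1 w = membership \<F>1 v \<longleftrightarrow> w \<in> fst p" if "v \<in> fst p" "w \<in> V" for v w
        using cls pairs[OF p] that by blast
      show "membership \<F>1 w = membership \<F>1 v \<longleftrightarrow> w \<in> snd p" if "v \<in> snd p" "w \<in> V" for v w
        using cls pairs[OF p] that by blast
    qed (use XY(1,2)[OF p] p in \<open>auto simp: \<F>2_def\<close>)
    finally show "\<epsilon> ^ 4 * (real L)\<^sup>2 \<le> sum ?d (X p \<times> Y p)" .
  qed
  also have "\<dots> = sum ?d (\<Union>p\<in>Irr. X p \<times> Y p)"
  proof (rule sum.UNION_disjoint[symmetric, OF finI])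
    show "\<forall>p\<in>Irr. finite (X p \<times> Y p)"
      using sub V by (meson finite_SigmaI finite_subset)
    show "\<forall>p\<in>Irr. \<forall>q\<in>Irr. p \<noteq> q \<longrightarrow> (X p \<times> Y p) \<inter> (X q \<times> Y q) = {}"
    proof (intro ballI impI)
      fix p q assume pq: "p \<in> Irr" "q \<in> Irr" "p \<noteq> q"
      then have "fst p \<noteq> fst q \<or> snd p \<noteq> snd q"
        by (auto simp: prod_eq_iff)
      then have "fst p \<inter> fst q = {} \<or> snd p \<inter> snd q = {}"
        using pairs[OF pq(1)] pairs[OF pq(2)] \<B>(2) by (auto simp: disjoint_def)
      then show "(X p \<times> Y p) \<inter> (X q \<times> Y q) = {}"
        using XY(1,2)[OF pq(1)] XY(1,2)[OF pq(2)] by blast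
    qed
  qed
  also have "\<dots> \<le> sum ?d (V \<times> V)"
  proof (rule sum_mono2)
    show "(\<Union>p\<in>Irr. X p \<times> Y p) \<subseteq> V \<times> V"
      using sub by (intro UN_least Sigma_mono) auto
  qed (use V in auto)
  also have "\<dots> = energy V E \<F>2 - energy V E \<F>1"
    using energy_refine[OF V, of \<F>1 \<F>2 E] by (simp add: \<F>2_def)
  also have "\<dots> \<le> energy V E \<F>2 - energy V E \<F>"
    using energy_mono[OF V, of \<F> \<F>1 E] by (simp add: \<F>1_def)
  finally show ?thesis
    using fin2 card2 by (intro exI[of _ \<F>2]) auto
qed

section \<open>The regularity lemma\<close>

text \<open>Up to a fraction \<epsilon> of the vertices may lie outside the blocks. Having at least
  1/\<epsilon> blocks makes the diagonal pairs at most an \<epsilon> fraction of all ordered pairs,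
  the same bound as for the irregular ones.\<close>

definition regular_blocks :: "'a set \<Rightarrow> 'a set set \<Rightarrow> real \<Rightarrow> nat \<Rightarrow> 'a set set \<Rightarrow> bool" where
  "regular_blocks V E \<epsilon> L \<B> \<longleftrightarrow>
     finite \<B> \<and> disjoint \<B> \<and> \<Union>\<B> \<subseteq> V \<and> (\<forall>B\<in>\<B>. card B = L) \<and>
     real (card \<B>) * real L \<ge> (1 - \<epsilon>) * real (card V) \<and> 1 \<le> \<epsilon> * real (card \<B>) \<and>
     real (card {(A, B) \<in> \<B> \<times> \<B>. A \<noteq> B \<and> \<not> eps_regular E \<epsilon> A B}) \<le> \<epsilon> * (real (card \<B>))\<^sup>2"

lemma card_Union_disjoint_const:
  assumes "finite \<B>" "disjoint \<B>" "\<And>B. B \<in> \<B> \<Longrightarrow> finite B \<and> card B = L"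
  shows "card (\<Union>\<B>) = card \<B> * L"
proof -
  have "card (\<Union>\<B>) = sum card \<B>"
    using assms by (intro card_Union_disjoint) (auto simp: disjoint_def pairwise_def disjnt_def)
  then show ?thesis
    using assms(3) by simp
qed

lemma regularity_step:
  fixes V :: "'a set" and m :: nat
  assumes \<epsilon>: "0 < \<epsilon>" "\<epsilon> \<le> 1 / 2" and V: "finite V" and \<F>: "finite \<F>" "card \<F> \<le> m"
    and K: "K = 2 ^ (m + 2) / \<epsilon>" and n: "real (card V) \<ge> K"
  shows "(\<exists>L \<B>. regular_blocks V E \<epsilon> L \<B> \<and> real L \<ge> real (card V) / K) \<or>
    (\<exists>\<F>'. finite \<F>' \<and> real (card \<F>') \<le> real m + K + 2 * K\<^sup>2 \<and>
      energy V E \<F>' \<ge> energy V E \<F> + \<epsilon> ^ 5 * (1 - \<epsilon>)\<^sup>2 * (real (card V))\<^sup>2)"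
proof -
  let ?n = "real (card V)"
  \<comment> \<open>The factor 2 absorbs the rounding: L is at least n/K because n/K is at least 1.
    As L is at most 2n/K, the at most 2^m classes leave over at most 2^m * 2n/K = \<epsilon>n/2
    vertices, which dictates the form of K.\<close>
  define L where "L = nat \<lfloor>2 * ?n / K\<rfloor>"
  have Kpos: "K > 0"
    using \<epsilon> by (simp add: K)
  have npos: "?n > 0"
    using Kpos n by linarith
  have nK: "?n / K \<ge> 1"
    using n Kpos by simp
  have L: "real L \<le> 2 * ?n / K" "real L \<ge> ?n / K"
  proof -
    have "real L = of_int \<lfloor>2 * ?n / K\<rfloor>"
      using Kpos by (simp add: L_def)
    then show "real L \<le> 2 * ?n / K" "real L \<ge> ?n / K"
      using nK by linarith+
  qed
  have Lpos: "L > 0"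
    using L(2) nK by (cases L) auto
  obtain \<B> where \<B>: "finite \<B>" "disjoint \<B>" "\<Union>\<B> \<subseteq> V"
    "\<forall>B\<in>\<B>. card B = L \<and> (\<forall>x\<in>B. \<forall>y\<in>B. membership \<F> x = membership \<F> y)"
    "card (V - \<Union>\<B>) \<le> L * card (membership \<F> ` V)"
    using chunk_fibres[OF V Lpos, of "membership \<F>"] by (elim exE conjE)
  let ?k = "real (card \<B>)"
  have "card (membership \<F> ` V) \<le> card (Pow \<F>)"
    using \<F>(1) by (intro card_mono) (auto simp: membership_def)
  also have "\<dots> \<le> 2 ^ m"
    using \<F> by (simp add: card_Pow)
  finally have "card (V - \<Union>\<B>) \<le> L * 2 ^ m"
    using \<B>(5) by (meson le_trans mult_le_mono2)
  then have "real (card (V - \<Union>\<B>)) \<le> real (L * 2 ^ m)"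
    by (rule of_nat_mono)
  also have "\<dots> = real L * 2 ^ m"
    by simp
  also have "\<dots> \<le> 2 * ?n / K * 2 ^ m"
    using L(1) by (intro mult_right_mono) auto
  also have "\<dots> = \<epsilon> * ?n / 2"
    using \<epsilon> by (simp add: K power_add)
  finally have rest: "real (card (V - \<Union>\<B>)) \<le> \<epsilon> * ?n / 2" .
  have fin: "finite B" if "B \<in> \<B>" for B
    using that \<B>(4) Lpos by (metis card.infinite less_irrefl)
  have cU: "card (\<Union>\<B>) = card \<B> * L"
    using \<B> fin by (intro card_Union_disjoint_const) blast+
  have "card V = card (\<Union>\<B>) + card (V - \<Union>\<B>)"
    using \<B>(3) V by (metis card_Diff_subset card_mono finite_subset le_add_diff_inverse)
  then have nsplit: "?n = ?k * real L + real (card (V - \<Union>\<B>))"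
    by (simp add: cU)
  have \<epsilon>n: "\<epsilon> * ?n \<le> ?n / 2" "\<epsilon> * ?n > 0"
    using \<epsilon> npos by (auto simp: mult_right_mono[of \<epsilon> "1/2" ?n, simplified])
  have kL: "?k * real L \<ge> (1 - \<epsilon>) * ?n" "?k * real L \<ge> 3 / 4 * ?n"
    using rest nsplit \<epsilon>n by (simp_all add: algebra_simps)
  have "?k * (?n / K) \<le> ?k * real L"
    using L(2) by (intro mult_left_mono) auto
  also have "\<dots> \<le> ?n"
    using nsplit by simp
  finally have kK: "?k \<le> K"
    using npos Kpos by (simp add: field_simps)
  \<comment> \<open>This makes a single block at most \<epsilon>n/2 in size. The blocks cover at
    least 3n/4 vertices, so there are more than 1/\<epsilon> of them.\<close>
  have "2 / K \<le> \<epsilon> / 2"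
  proof -
    have "2 / K = \<epsilon> / 2 * (1 / 2 ^ m)"
      by (simp add: K power_add)
    also have "\<dots> \<le> \<epsilon> / 2 * 1"
      using \<epsilon> by (intro mult_left_mono) auto
    finally show ?thesis by simp
  qed
  then have "2 / K * ?n \<le> \<epsilon> / 2 * ?n"
    by (rule mult_right_mono) simp
  then have "real L \<le> \<epsilon> / 2 * ?n"
    using L(1) by simp
  then have "?k * real L \<le> ?k * (\<epsilon> / 2 * ?n)"
    by (rule mult_left_mono) simp
  then have "3 / 4 * ?n \<le> (?k * \<epsilon> / 2) * ?n"
    using kL(2) by simp
  then have "3 / 4 \<le> ?k * \<epsilon> / 2"
    using npos by (rule mult_right_le_imp_le)
  then have k\<epsilon>: "1 \<le> \<epsilon> * ?k"
    by (simp add: mult.commute)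
  define Irr where "Irr = {(A, B) \<in> \<B> \<times> \<B>. A \<noteq> B \<and> \<not> eps_regular E \<epsilon> A B}"
  show ?thesis
  proof (cases "real (card Irr) \<le> \<epsilon> * ?k\<^sup>2")
    case True
    then have "regular_blocks V E \<epsilon> L \<B>"
      unfolding regular_blocks_def Irr_def using \<B> kL(1) k\<epsilon> by blast
    then show ?thesis
      using L(2) by blast
  next
    case False
    obtain \<F>' where \<F>': "finite \<F>'" "card \<F>' \<le> card \<F> + card \<B> + 2 * (card \<B>)\<^sup>2"
      "energy V E \<F> + real (card Irr) * (\<epsilon> ^ 4 * (real L)\<^sup>2) \<le> energy V E \<F>'"
    proof -
      have "\<exists>\<F>'. finite \<F>' \<and> card \<F>' \<le> card \<F> + card \<B> + 2 * (card \<B>)\<^sup>2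
        \<and> energy V E \<F> + real (card Irr) * (\<epsilon> ^ 4 * (real L)\<^sup>2) \<le> energy V E \<F>'"
      proof (rule energy_increment[OF V \<F>(1) \<epsilon>(1) \<B>(1-3)])
        show "card B = L" if "B \<in> \<B>" for B
          using \<B>(4) that by blast
        show "membership \<F> x = membership \<F> y" if "B \<in> \<B>" "x \<in> B" "y \<in> B" for B x y
          using \<B>(4) that by blast
      qed (auto simp: Irr_def)
      then show thesis
        using that by blast
    qed
    have "real (card \<F>') \<le> real (card \<F> + card \<B> + 2 * (card \<B>)\<^sup>2)"
      using \<F>'(2) of_nat_le_iff by blast
    also have "\<dots> = real (card \<F>) + ?k + 2 * ?k\<^sup>2"
      by simp
    also have "\<dots> \<le> real m + K + 2 * K\<^sup>2"
      using \<F>(2) kK by (intro add_mono mult_left_mono power_mono) auto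
    finally have c: "real (card \<F>') \<le> real m + K + 2 * K\<^sup>2" .
    \<comment> \<open>More than \<epsilon>k^2 pairs each gain \<epsilon>^4 L^2, and kL is at least
      (1 - \<epsilon>)n.\<close>
    have "\<epsilon> ^ 5 * (1 - \<epsilon>)\<^sup>2 * ?n\<^sup>2 = \<epsilon> ^ 5 * ((1 - \<epsilon>) * ?n)\<^sup>2"
      by (simp add: power_mult_distrib)
    also have "\<dots> \<le> \<epsilon> ^ 5 * (?k * real L)\<^sup>2"
      using kL(1) \<epsilon> by (intro mult_left_mono power_mono) auto
    also have "\<dots> = \<epsilon> * ?k\<^sup>2 * (\<epsilon> ^ 4 * (real L)\<^sup>2)"
      by (simp add: power_mult_distrib eval_nat_numeral)
    also have "\<dots> \<le> real (card Irr) * (\<epsilon> ^ 4 * (real L)\<^sup>2)"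
      using False \<epsilon> by (intro mult_right_mono) auto
    finally have "energy V E \<F> + \<epsilon> ^ 5 * (1 - \<epsilon>)\<^sup>2 * ?n\<^sup>2 \<le> energy V E \<F>'"
      using \<F>'(3) by linarith
    then show ?thesis
      using \<F>'(1) c by blast
  qed
qed

text \<open>Here \<open>j\<close> bounds the number of increments still possible: each failed step
  raises the energy by \<epsilon>^5 (1 - \<epsilon>)^2 n^2, and at \<open>j = 0\<close> the
  hypothesis contradicts \<open>energy_le\<close>. The size bound \<open>m\<close> must be arbitrary
  in the induction because the family grows, but \<open>M\<close> depends only on \<epsilon>,
  \<open>m\<close> and \<open>j\<close>, never on the graph.\<close>

lemma regularity_iterate:
  fixes \<epsilon> :: real
  assumes \<epsilon>: "0 < \<epsilon>" "\<epsilon> \<le> 1 / 2"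
  shows "\<exists>M>0. \<forall>(V :: 'a set) E \<F>. finite V \<longrightarrow> real (card V) \<ge> M \<longrightarrow> finite \<F> \<longrightarrow> card \<F> \<le> m \<longrightarrow>
    energy V E \<F> > (1 - real j * (\<epsilon> ^ 5 * (1 - \<epsilon>)\<^sup>2)) * (real (card V))\<^sup>2 \<longrightarrow>
    (\<exists>L \<B>. regular_blocks V E \<epsilon> L \<B> \<and> real L \<ge> real (card V) / M)"
proof (induction j arbitrary: m)
  case 0
  have "\<not> energy V E \<F> > (real (card V))\<^sup>2" if "finite V" for V :: "'a set" and E \<F>
    using energy_le[OF that] by (simp add: not_less)
  then show ?case
    by (intro exI[of _ 1]) simp
next
  case (Suc j)
  let ?\<gamma> = "\<epsilon> ^ 5 * (1 - \<epsilon>)\<^sup>2"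
  define K where "K = 2 ^ (m + 2) / \<epsilon>"
  define m' where "m' = nat \<lfloor>real m + K + 2 * K\<^sup>2\<rfloor>"
  have Kpos: "K > 0"
    using \<epsilon> by (simp add: K_def)
  from Suc.IH[of m'] obtain M where M: "M > 0"
    and IH: "\<And>(V :: 'a set) E \<F>. finite V \<Longrightarrow> real (card V) \<ge> M \<Longrightarrow> finite \<F> \<Longrightarrow> card \<F> \<le> m' \<Longrightarrow>
      energy V E \<F> > (1 - real j * ?\<gamma>) * (real (card V))\<^sup>2 \<Longrightarrow>
      \<exists>L \<B>. regular_blocks V E \<epsilon> L \<B> \<and> real L \<ge> real (card V) / M"
    by blast
  have weaken: "real (card V) / max M K \<le> real (card V) / M" "real (card V) / max M K \<le> real (card V) / K"
    for V :: "'a set"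
    using M Kpos by (intro divide_left_mono; simp add: max_def)+
  have "\<exists>L \<B>. regular_blocks V E \<epsilon> L \<B> \<and> real L \<ge> real (card V) / max M K"
    if V: "finite V" "real (card V) \<ge> max M K" and \<F>: "finite \<F>" "card \<F> \<le> m"
      and en: "energy V E \<F> > (1 - real (Suc j) * ?\<gamma>) * (real (card V))\<^sup>2"
    for V :: "'a set" and E \<F>
  proof -
    consider (good) L \<B> where "regular_blocks V E \<epsilon> L \<B>" "real L \<ge> real (card V) / K"
      | (inc) \<F>' where "finite \<F>'" "real (card \<F>') \<le> real m + K + 2 * K\<^sup>2"
          "energy V E \<F>' \<ge> energy V E \<F> + ?\<gamma> * (real (card V))\<^sup>2"
      using regularity_step[OF \<epsilon> V(1) \<F> K_def, of E] V(2) by auto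
    then show ?thesis
    proof cases
      case good
      then show ?thesis
        using weaken(2)[of V] by (meson order_trans)
    next
      case inc
      have "(1 - real j * ?\<gamma>) * (real (card V))\<^sup>2
          = (1 - real (Suc j) * ?\<gamma>) * (real (card V))\<^sup>2 + ?\<gamma> * (real (card V))\<^sup>2"
        by (simp add: algebra_simps)
      then have "energy V E \<F>' > (1 - real j * ?\<gamma>) * (real (card V))\<^sup>2"
        using inc(3) en by linarith
      moreover have "card \<F>' \<le> m'"
        using inc(2) by (simp add: m'_def le_nat_floor)
      ultimately have "\<exists>L \<B>. regular_blocks V E \<epsilon> L \<B> \<and> real L \<ge> real (card V) / M"
        using IH[OF V(1) _ inc(1)] V(2) by simp
      then show ?thesis
        using weaken(1)[of V] by (meson order_trans)
    qed
  qed
  moreover have "max M K > 0"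
    using M by simp
  ultimately show ?case
    by blast
qed

theorem regularity_lemma:
  fixes \<epsilon> :: real
  assumes \<epsilon>: "0 < \<epsilon>" "\<epsilon> \<le> 1 / 2"
  shows "\<exists>M>0. \<forall>(V :: 'a set) E. finite V \<longrightarrow> real (card V) \<ge> M \<longrightarrow>
    (\<exists>L \<B>. regular_blocks V E \<epsilon> L \<B> \<and> real L \<ge> real (card V) / M)"
proof -
  let ?\<gamma> = "\<epsilon> ^ 5 * (1 - \<epsilon>)\<^sup>2"
  have "?\<gamma> > 0"
    using \<epsilon> by simp
  \<comment> \<open>This \<open>j\<close> makes the energy threshold negative on nonempty vertex
    sets, so the iteration can start from the empty family, that is, from the trivial
    partition.\<close>
  then obtain j where j: "real j * ?\<gamma> > 1"
    using reals_Archimedean3 by blast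
  obtain M where M: "M > 0" and *: "\<forall>(V :: 'a set) E \<F>. finite V \<longrightarrow> real (card V) \<ge> M \<longrightarrow> finite \<F> \<longrightarrow>
      card \<F> \<le> 0 \<longrightarrow> energy V E \<F> > (1 - real j * ?\<gamma>) * (real (card V))\<^sup>2 \<longrightarrow>
      (\<exists>L \<B>. regular_blocks V E \<epsilon> L \<B> \<and> real L \<ge> real (card V) / M)"
    using regularity_iterate[OF \<epsilon>, of 0 j] by blast
  have "energy V E {} > (1 - real j * ?\<gamma>) * (real (card V))\<^sup>2" if "real (card V) \<ge> M" for V :: "'a set" and E
  proof -
    have "(1 - real j * ?\<gamma>) * (real (card V))\<^sup>2 < 0"
      using j M that by (intro mult_neg_pos) auto
    also have "0 \<le> energy V E {}"
      by (rule energy_nonneg)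
    finally show ?thesis .
  qed
  then show ?thesis
    using M * by (intro exI[of _ M]) (auto dest: spec[of _ "{}"])
qed

section \<open>The theorem\<close>

text \<open>Vertices are sent injectively to subsets of a \<open>k\<close>-element set with 2^k at
  most 2n. The deviation of an edge count from |A||B|/2 is half a sum over a submatrix of the parity
  matrix, so Lindsey's lemma bounds its square by 2n|A||B|/4.\<close>

lemma quasirandom_graph_exists:
  assumes "n > 0"
  shows "\<exists>E\<subseteq>[{..<n}]\<^bsup>2\<^esup>. \<forall>A B. A \<subseteq> {..<n} \<longrightarrow> B \<subseteq> {..<n} \<longrightarrow> A \<inter> B = {} \<longrightarrow>
    (real (card (edges_between E A B)) - real (card A) * real (card B) / 2)\<^sup>2
      \<le> real n * (real (card A) * real (card B))"
proof -
  define k where "k = (LEAST k. n \<le> 2 ^ k)"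
  have k1: "n \<le> 2 ^ k"
    unfolding k_def by (rule LeastI[of _ n]) (simp add: less_imp_le)
  have k2: "2 ^ k \<le> 2 * n"
  proof (cases k)
    case 0
    then show ?thesis using assms by simp
  next
    case (Suc i)
    then have "\<not> n \<le> 2 ^ i"
      using not_less_Least[of i "\<lambda>k. n \<le> 2 ^ k"] by (simp add: k_def)
    then show ?thesis
      by (simp add: Suc)
  qed
  have "card {..<n} \<le> card (Pow {..<k})"
    using k1 by (simp add: card_Pow)
  then obtain \<phi> where \<phi>: "inj_on \<phi> {..<n}" "\<phi> ` {..<n} \<subseteq> Pow {..<k}"
    using inj_on_iff_card_le[of "{..<n}" "Pow {..<k}"] by auto
  define h where "h a b = ((-1) ^ card (\<phi> a \<inter> \<phi> b) :: real)" for a b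
  have h_sym: "h a b = h b a" for a b
    by (simp add: h_def Int_commute)
  have h_cases: "h a b = 1 \<or> h a b = -1" for a b
    unfolding h_def by (metis neg_one_even_power neg_one_odd_power)
  define E where "E = {{a, b} | a b. a < n \<and> b < n \<and> a \<noteq> b \<and> h a b = 1}"
  have inE: "{a, b} \<in> E \<longleftrightarrow> h a b = 1" if "a < n" "b < n" "a \<noteq> b" for a b
    unfolding E_def using that h_sym by (auto simp: doubleton_eq_iff)
  have E: "E \<subseteq> [{..<n}]\<^bsup>2\<^esup>"
    by (auto simp: E_def)
  have "(real (card (edges_between E A B)) - real (card A) * real (card B) / 2)\<^sup>2
      \<le> real n * (real (card A) * real (card B))"
    if AB: "A \<subseteq> {..<n}" "B \<subseteq> {..<n}" "A \<inter> B = {}" for A B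
  proof -
    have fin: "finite A" "finite B"
      using AB(1,2) by (auto intro: finite_subset)
    let ?c = "real (card A) * real (card B)"
    have "real (card (edges_between E A B)) = sum (adj E) (A \<times> B)"
      using fin AB(3) by (rule card_edges_between_sum_adj)
    \<comment> \<open>The 0/1 adjacency is (1 + h)/2 for the sign h. Disjointness of
      \<open>A\<close> and \<open>B\<close> excludes the pairs with a = b, where \<open>E\<close>
      has no edge whatever the sign.\<close>
    also have "\<dots> = (\<Sum>(a, b)\<in>A \<times> B. 1 / 2 + h a b / 2)"
    proof (rule sum.cong[OF refl])
      fix p assume "p \<in> A \<times> B"
      then obtain a b where p: "p = (a, b)" "a \<in> A" "b \<in> B" by auto
      then have "a < n" "b < n" "a \<noteq> b"
        using AB by auto
      then show "adj E p = (case p of (a, b) \<Rightarrow> 1 / 2 + h a b / 2)"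
        using h_cases[of a b] by (auto simp: p(1) adj_def inE)
    qed
    also have "\<dots> = (\<Sum>a\<in>A. \<Sum>b\<in>B. 1 / 2 + h a b / 2)"
      by (rule sum.cartesian_product[symmetric])
    also have "\<dots> = ?c / 2 + (\<Sum>a\<in>A. \<Sum>b\<in>B. h a b) / 2"
      by (simp add: sum.distrib sum_divide_distrib)
    also have "(\<Sum>a\<in>A. \<Sum>b\<in>B. h a b) = (\<Sum>S\<in>\<phi> ` A. \<Sum>T\<in>\<phi> ` B. (-1) ^ card (S \<inter> T))"
      using \<phi>(1) AB(1,2) by (simp add: sum.reindex inj_on_subset h_def)
    finally have e: "real (card (edges_between E A B)) - ?c / 2
        = (\<Sum>S\<in>\<phi> ` A. \<Sum>T\<in>\<phi> ` B. (-1) ^ card (S \<inter> T)) / 2"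
      by simp
    have "(\<Sum>S\<in>\<phi> ` A. \<Sum>T\<in>\<phi> ` B. (-1) ^ card (S \<inter> T) :: real)\<^sup>2
        \<le> 2 ^ card {..<k} * real (card (\<phi> ` A)) * real (card (\<phi> ` B))"
      using \<phi>(2) AB(1,2) by (intro Lindsey_inter_parity) auto
    also have "card (\<phi> ` A) = card A"
      using \<phi>(1) AB(1) by (meson card_image inj_on_subset)
    also have "card (\<phi> ` B) = card B"
      using \<phi>(1) AB(2) by (meson card_image inj_on_subset)
    also have "2 ^ card {..<k} * real (card A) * real (card B) \<le> 2 * real n * real (card A) * real (card B)"
    proof (intro mult_right_mono)
      have "real (2 ^ k) \<le> real (2 * n)"
        using k2 by (rule of_nat_mono)
      then show "2 ^ card {..<k} \<le> 2 * real n"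
        by simp
    qed auto
    finally have "(\<Sum>S\<in>\<phi> ` A. \<Sum>T\<in>\<phi> ` B. (-1) ^ card (S \<inter> T) :: real)\<^sup>2 \<le> 2 * (real n * ?c)"
      by (simp add: mult.assoc)
    moreover have "0 \<le> real n * ?c"
      by simp
    ultimately have "(\<Sum>S\<in>\<phi> ` A. \<Sum>T\<in>\<phi> ` B. (-1) ^ card (S \<inter> T) :: real)\<^sup>2 / 4 \<le> real n * ?c"
      by linarith
    then show ?thesis
      unfolding e by (simp add: power_divide)
  qed
  with E show ?thesis
    by (intro exI[of _ E]) simp
qed

section \<open>Counting edits over pairs of blocks\<close>

lemma card_ordered_edges_le:
  assumes "finite F" "F \<subseteq> [V]\<^bsup>2\<^esup>"
  shows "card {(a, b). {a, b} \<in> F} \<le> 2 * card F" and "finite {(a, b). {a, b} \<in> F}"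
proof -
  have "finite {(a, b). {a, b} = e} \<and> card {(a, b). {a, b} = e} \<le> 2" if "e \<in> F" for e
  proof -
    obtain x y where e: "e = {x, y}"
      using subsetD[OF assms(2) \<open>e \<in> F\<close>] by (rule nsets2_E)
    have eq: "{(a, b). {a, b} = e} = {(x, y), (y, x)}"
      unfolding e doubleton_eq_iff by auto
    show ?thesis
      unfolding eq using card_length[of "[(x, y), (y, x)]"] by simp
  qed
  moreover have "{(a, b). {a, b} \<in> F} = (\<Union>e\<in>F. {(a, b). {a, b} = e})"
    by auto
  moreover have "card (\<Union>e\<in>F. {(a, b). {a, b} = e}) \<le> (\<Sum>e\<in>F. card {(a, b). {a, b} = e})"
    using assms(1) by (rule card_UN_le)
  moreover have "(\<Sum>e\<in>F. card {(a, b). {a, b} = e}) \<le> (\<Sum>e\<in>F. 2)"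
    using calculation(1) by (intro sum_mono) blast
  ultimately show "card {(a, b). {a, b} \<in> F} \<le> 2 * card F" and "finite {(a, b). {a, b} \<in> F}"
    using assms(1) by auto
qed

text \<open>Distinct pairs in \<open>Z\<close> span disjoint rectangles, so each ordered edge is
  counted at most once. The factor 2 is there because \<open>Z\<close> may contain a pair in both
  orders.\<close>

lemma sum_edges_between_pairs_le:
  assumes F: "finite F" "F \<subseteq> [V]\<^bsup>2\<^esup>"
    and \<B>: "disjoint \<B>" "finite \<B>"
    and Z: "Z \<subseteq> \<B> \<times> \<B>" "\<And>A B. (A, B) \<in> Z \<Longrightarrow> A \<noteq> B"
    and c: "\<And>A B. (A, B) \<in> Z \<Longrightarrow> c \<le> real (card (edges_between F A B))"
  shows "c * real (card Z) \<le> 2 * real (card F)"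
proof -
  let ?P = "\<lambda>z. {(a, b) \<in> fst z \<times> snd z. {a, b} \<in> F}"
  have finZ: "finite Z"
    using Z(1) \<B>(2) by (meson finite_SigmaI finite_subset)
  note fO = card_ordered_edges_le[OF F]
  have dis: "A \<inter> B = {}" if "A \<in> \<B>" "B \<in> \<B>" "A \<noteq> B" for A B
    using that \<B>(1) by (auto simp: disjoint_def)
  have "c * real (card Z) = (\<Sum>z\<in>Z. c)"
    by simp
  also have "\<dots> \<le> (\<Sum>z\<in>Z. real (card (?P z)))"
  proof (rule sum_mono)
    fix z assume z: "z \<in> Z"
    obtain A B where AB: "z = (A, B)" by (cases z)
    then have "A \<inter> B = {}"
      using z Z dis by blast
    then show "c \<le> real (card (?P z))"
      using c[of A B] z AB card_edges_between[of A B F] by simp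
  qed
  also have "\<dots> = real (\<Sum>z\<in>Z. card (?P z))"
    by simp
  also have "(\<Sum>z\<in>Z. card (?P z)) = card (\<Union>z\<in>Z. ?P z)"
  proof (rule card_UN_disjoint[symmetric, OF finZ])
    show "\<forall>z\<in>Z. finite (?P z)"
      using fO(2) by (auto intro: rev_finite_subset)
    show "\<forall>z\<in>Z. \<forall>z'\<in>Z. z \<noteq> z' \<longrightarrow> ?P z \<inter> ?P z' = {}"
    proof (intro ballI impI)
      fix z z' assume z: "z \<in> Z" "z' \<in> Z" "z \<noteq> z'"
      then have "fst z \<in> \<B>" "snd z \<in> \<B>" "fst z' \<in> \<B>" "snd z' \<in> \<B>" "fst z \<noteq> fst z' \<or> snd z \<noteq> snd z'"
        using Z(1) by (auto simp: prod_eq_iff)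
      then have "fst z \<inter> fst z' = {} \<or> snd z \<inter> snd z' = {}"
        using dis by blast
      then show "?P z \<inter> ?P z' = {}"
        by blast
    qed
  qed
  also have "card (\<Union>z\<in>Z. ?P z) \<le> card {(a, b). {a, b} \<in> F}"
    using fO(2) by (intro card_mono) auto
  also have "\<dots> \<le> 2 * card F"
    by (rule fO(1))
  finally show ?thesis
    by simp
qed

lemma card_edges_between_symmetric_difference:
  assumes "finite E" "finite D" "finite A"
  shows "\<bar>real (card (edges_between E X Y)) - real (card (edges_between ((E - D) \<union> A) X Y))\<bar>
    \<le> real (card (edges_between (D \<union> A) X Y))"
proof -
  let ?E' = "(E - D) \<union> A"
  have fin: "finite (edges_between G X Y)" if "finite G" for G
    using that by (simp add: edges_between_def)
  have "card (edges_between E X Y) \<le> card (edges_between ?E' X Y \<union> edges_between (D \<union> A) X Y)"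
    using fin assms by (intro card_mono) (auto simp: edges_between_def)
  also have "\<dots> \<le> card (edges_between ?E' X Y) + card (edges_between (D \<union> A) X Y)"
    by (rule card_Un_le)
  finally have 1: "card (edges_between E X Y) \<le> card (edges_between ?E' X Y) + card (edges_between (D \<union> A) X Y)" .
  have "card (edges_between ?E' X Y) \<le> card (edges_between E X Y \<union> edges_between (D \<union> A) X Y)"
    using fin assms by (intro card_mono) (auto simp: edges_between_def)
  also have "\<dots> \<le> card (edges_between E X Y) + card (edges_between (D \<union> A) X Y)"
    by (rule card_Un_le)
  finally show ?thesis
    using 1 by linarith
qed

section \<open>Finding a configuration among regular blocks\<close>

lemma configuration_of_blocks:
  assumes "disjoint I" "\<Union>I \<subseteq> V" "card I = r" "r > 0" "\<And>B. B \<in> I \<Longrightarrow> card B = L"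
    and "\<And>A B. A \<in> I \<Longrightarrow> B \<in> I \<Longrightarrow> A \<noteq> B \<Longrightarrow> eps_regular E \<epsilon> A B \<and> density E A B \<in> {\<delta><..<1 - \<delta>}"
  shows "\<exists>W. configuration V E \<epsilon> r L \<delta> W"
proof -
  have "finite I"
    using assms(3,4) by (metis card.infinite less_irrefl)
  then obtain W where W: "bij_betw W {1..r} I"
    using ex_bij_betw_nat_finite_1 assms(3) by blast
  have mem: "W i \<in> I" if "i \<in> {1..r}" for i
    using W that by (auto simp: bij_betw_def)
  have neq: "W i \<noteq> W j" if "i \<in> {1..r}" "j \<in> {1..r}" "i \<noteq> j" for i j
    using inj_on_contraD[OF bij_betw_imp_inj_on[OF W]] that by blast
  have "disjoint_family_on W {1..r}"
    unfolding disjoint_family_on_def by (intro ballI impI disjointD[OF assms(1)] mem neq)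
  moreover have "\<forall>i\<in>{1..r}. W i \<subseteq> V \<and> card (W i) = L"
    using mem assms(2,5) by blast
  moreover have "\<forall>i\<in>{1..r}. \<forall>j\<in>{1..r}. i < j \<longrightarrow>
      eps_regular E \<epsilon> (W i) (W j) \<and> density E (W i) (W j) \<in> {\<delta><..<1 - \<delta>}"
    by (intro ballI impI assms(6) mem neq) auto
  ultimately show ?thesis
    unfolding configuration_def by blast
qed

text \<open>If no \<open>Suc s\<close> blocks are pairwise good, Turan's theorem yields at least
  k^2/s bad ordered pairs of blocks. The diagonal and the irregular pairs make up at most
  2\<epsilon>k^2 of them; the others have extreme density and together cost more edits than allowed.
  The condition on \<open>L\<close> keeps the density of every pair of blocks in the original graph
  within \<delta>/8 of 1/2.\<close>

lemma configuration_after_edits: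
  fixes V :: "'a set"
  assumes V: "finite V" and E: "E \<subseteq> [V]\<^bsup>2\<^esup>"
    and qr: "\<And>X Y. X \<subseteq> V \<Longrightarrow> Y \<subseteq> V \<Longrightarrow> X \<inter> Y = {} \<Longrightarrow>
      (real (card (edges_between E X Y)) - real (card X) * real (card Y) / 2)\<^sup>2
        \<le> real (card V) * (real (card X) * real (card Y))"
    and s: "s > 0" and \<delta>: "0 < \<delta>" and \<epsilon>: "0 < \<epsilon>" "\<epsilon> < 1" "\<epsilon> < \<delta> / (16 * real s)"
    and D: "D \<subseteq> E" and A: "A \<subseteq> [V]\<^bsup>2\<^esup> - E"
    and few: "real (card D + card A) < (real (card V))\<^sup>2 / (4 * real s) * (1 - 3 * \<delta>) * (1 - \<epsilon>)\<^sup>2"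
    and \<B>: "regular_blocks V ((E - D) \<union> A) \<epsilon> L \<B>"
    and L: "real (card V) \<le> (\<delta> / 8 * real L)\<^sup>2"
  shows "\<exists>W. configuration V ((E - D) \<union> A) \<epsilon> (Suc s) L \<delta> W"
proof -
  define E' where "E' = (E - D) \<union> A"
  define F where "F = D \<union> A"
  let ?n = "real (card V)" and ?k = "real (card \<B>)" and ?s = "real s"
  have b: "finite \<B>" "disjoint \<B>" "\<Union>\<B> \<subseteq> V" "\<And>B. B \<in> \<B> \<Longrightarrow> card B = L"
    "?k * real L \<ge> (1 - \<epsilon>) * ?n" "1 \<le> \<epsilon> * ?k"
    "real (card {(X, Y) \<in> \<B> \<times> \<B>. X \<noteq> Y \<and> \<not> eps_regular E' \<epsilon> X Y}) \<le> \<epsilon> * ?k\<^sup>2"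
    using \<B> unfolding regular_blocks_def E'_def by auto
  have finV2: "finite ([V]\<^bsup>2\<^esup>)"
    using V by (rule finite_imp_finite_nsets)
  have fin: "finite E" "finite D" "finite A"
    using finV2 E D A by (meson Diff_subset finite_subset)+
  have "D \<inter> A = {}"
    using D A by auto
  then have F: "finite F" "F \<subseteq> [V]\<^bsup>2\<^esup>" "real (card F) = real (card D + card A)"
    unfolding F_def using fin E D A by (auto simp: card_Un_disjoint)
  \<comment> \<open>For larger \<delta> the edit budget would not be positive, contradicting
    \<open>few\<close>. The bound gives 1 - 9\<delta>/4 > 0, so \<open>c\<close> is
    nonnegative.\<close>
  have \<delta>3: "\<delta> < 1 / 3"
  proof (rule ccontr)
    assume "\<not> \<delta> < 1 / 3"
    then have "?n\<^sup>2 / (4 * ?s) * (1 - \<epsilon>)\<^sup>2 * (1 - 3 * \<delta>) \<le> 0"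
      by (intro mult_nonneg_nonpos) auto
    then show False
      using few by (simp add: mult.commute mult.left_commute)
  qed
  define Irr where "Irr = {(X, Y) \<in> \<B> \<times> \<B>. X \<noteq> Y \<and> \<not> eps_regular E' \<epsilon> X Y}"
  define Z where "Z = {(X, Y) \<in> \<B> \<times> \<B>. X \<noteq> Y \<and> density E' X Y \<notin> {\<delta><..<1 - \<delta>}}"
  define R where "R X Y \<longleftrightarrow> X = Y \<or> \<not> eps_regular E' \<epsilon> X Y \<or> density E' X Y \<notin> {\<delta><..<1 - \<delta>}" for X Y
  have R_sym: "R Y X" if "R X Y" for X Y
    using that unfolding R_def by (metis density_commute eps_regular_commute)
  \<comment> \<open>A lower bound for the edits spent on a pair of extreme density: it had to move
    from within \<delta>/8 of 1/2 to at most \<delta> or at least 1 - \<delta>, a distance of at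
    least 1/2 - \<delta> - \<delta>/8.\<close>
  define c where "c = (1 / 2 - 9 / 8 * \<delta>) * (real L)\<^sup>2"
  have "c * real (card Z) \<le> 2 * real (card F)"
  proof (rule sum_edges_between_pairs_le[OF F(1,2) b(2,1)])
    fix X Y assume "(X, Y) \<in> Z"
    then have XY: "X \<in> \<B>" "Y \<in> \<B>" "X \<noteq> Y" "density E' X Y \<le> \<delta> \<or> density E' X Y \<ge> 1 - \<delta>"
      by (auto simp: Z_def)
    have dis: "X \<inter> Y = {}" "X \<subseteq> V" "Y \<subseteq> V" "card X = L" "card Y = L"
      using XY(1-3) b by (auto simp: disjoint_def)
    have "(real (card (edges_between E X Y)) - (real L)\<^sup>2 / 2)\<^sup>2 \<le> ?n * (real L)\<^sup>2"
      using qr[OF dis(2,3,1)] by (simp add: dis(4,5) power2_eq_square)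
    also have "\<dots> \<le> (\<delta> / 8 * real L)\<^sup>2 * (real L)\<^sup>2"
      using L by (rule mult_right_mono) simp
    also have "\<dots> = (\<delta> / 8 * (real L)\<^sup>2)\<^sup>2"
      by (simp add: power2_eq_square)
    finally have q: "\<bar>real (card (edges_between E X Y)) - (real L)\<^sup>2 / 2\<bar> \<le> \<delta> / 8 * (real L)\<^sup>2"
      using \<delta> by (intro power2_le_imp_le[of "\<bar>_\<bar>"]) auto
    have ed: "\<bar>real (card (edges_between E X Y)) - real (card (edges_between E' X Y))\<bar> \<le> real (card (edges_between F X Y))"
      unfolding E'_def F_def by (rule card_edges_between_symmetric_difference[OF fin])
    have d: "density E' X Y = real (card (edges_between E' X Y)) / (real L)\<^sup>2"
      by (simp add: density_def dis power2_eq_square)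
    show "c \<le> real (card (edges_between F X Y))"
    proof (cases "L = 0")
      case True
      then show ?thesis by (simp add: c_def)
    next
      case False
      then have "real (card (edges_between E' X Y)) \<le> \<delta> * (real L)\<^sup>2 \<or>
          real (card (edges_between E' X Y)) \<ge> (1 - \<delta>) * (real L)\<^sup>2"
        using XY(4) unfolding d by (simp add: divide_le_eq le_divide_eq)
      moreover have "c = (real L)\<^sup>2 / 2 - 9 / 8 * (\<delta> * (real L)\<^sup>2)" "(1 - \<delta>) * (real L)\<^sup>2 = (real L)\<^sup>2 - \<delta> * (real L)\<^sup>2"
        by (simp_all add: c_def algebra_simps)
      ultimately show ?thesis
        using q ed by linarith
    qed
  qed (auto simp: Z_def)
  then have cZ: "?s * (c * real (card Z)) \<le> ?s * (2 * real (card F))"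
    by (rule mult_left_mono) simp
  have "?s * real (card {(X, Y) \<in> \<B> \<times> \<B>. R X Y}) < ?k\<^sup>2"
  proof (rule ccontr)
    assume "\<not> ?thesis"
    then have many: "?k\<^sup>2 \<le> ?s * real (card {(X, Y) \<in> \<B> \<times> \<B>. R X Y})"
      by simp
    have "{(X, Y) \<in> \<B> \<times> \<B>. R X Y} \<subseteq> (\<lambda>X. (X, X)) ` \<B> \<union> Irr \<union> Z"
      by (auto simp: R_def Irr_def Z_def)
    moreover have "finite Irr" "finite Z"
      by (rule finite_subset[of _ "\<B> \<times> \<B>"]; auto simp: Irr_def Z_def b(1))+
    ultimately have "card {(X, Y) \<in> \<B> \<times> \<B>. R X Y} \<le> card ((\<lambda>X. (X, X)) ` \<B> \<union> Irr \<union> Z)"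
      using b(1) by (intro card_mono) auto
    also have "\<dots> \<le> card ((\<lambda>X. (X, X)) ` \<B>) + card Irr + card Z"
      by (meson add_mono card_Un_le le_refl le_trans)
    also have "\<dots> \<le> card \<B> + card Irr + card Z"
      using card_image_le[OF b(1)] by simp
    finally have "real (card {(X, Y) \<in> \<B> \<times> \<B>. R X Y}) \<le> ?k + real (card Irr) + real (card Z)"
      by linarith
    moreover have "?k \<le> \<epsilon> * ?k\<^sup>2"
      using mult_right_mono[OF b(6), of ?k] by (simp add: power2_eq_square mult.assoc)
    moreover have "real (card Irr) \<le> \<epsilon> * ?k\<^sup>2"
      using b(7) by (simp add: Irr_def)
    ultimately have "real (card {(X, Y) \<in> \<B> \<times> \<B>. R X Y}) \<le> 2 * \<epsilon> * ?k\<^sup>2 + real (card Z)"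
      by linarith
    then have "?s * real (card {(X, Y) \<in> \<B> \<times> \<B>. R X Y}) \<le> ?s * (2 * \<epsilon> * ?k\<^sup>2 + real (card Z))"
      by (rule mult_left_mono) simp
    with many have "?k\<^sup>2 \<le> 2 * (?s * \<epsilon>) * ?k\<^sup>2 + ?s * real (card Z)"
      by (simp add: algebra_simps)
    moreover have "?s * \<epsilon> \<le> \<delta> / 16"
      using \<epsilon>(3) s by (simp add: field_simps)
    then have "2 * (?s * \<epsilon>) * ?k\<^sup>2 \<le> \<delta> / 8 * ?k\<^sup>2"
      by (intro mult_right_mono) auto
    \<comment> \<open>As \<epsilon> < \<delta>/(16s), the diagonal and irregular pairs take only
      \<delta>/8 of the k^2 bad pairs supplied by Turan's theorem, after scaling by s.\<close>
    ultimately have sZ: "(1 - \<delta> / 8) * ?k\<^sup>2 \<le> ?s * real (card Z)"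
      by (simp add: algebra_simps)
    have "((1 - \<epsilon>) * ?n)\<^sup>2 \<le> (?k * real L)\<^sup>2"
      using b(5) \<epsilon>(2) by (intro power_mono) auto
    moreover have "0 \<le> (1 - 9 / 4 * \<delta>) * (1 - \<delta> / 8)"
      using \<delta> \<delta>3 by (intro mult_nonneg_nonneg) auto
    ultimately have "(1 - 9 / 4 * \<delta>) * (1 - \<delta> / 8) * ((1 - \<epsilon>) * ?n)\<^sup>2
        \<le> (1 - 9 / 4 * \<delta>) * (1 - \<delta> / 8) * (?k * real L)\<^sup>2"
      by (rule mult_left_mono)
    also have "\<dots> = 2 * c * ((1 - \<delta> / 8) * ?k\<^sup>2)"
      unfolding c_def by (simp add: power_mult_distrib)
    also have "\<dots> \<le> 2 * c * (?s * real (card Z))"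
      using sZ \<delta>3 by (intro mult_left_mono) (auto simp: c_def)
    also have "\<dots> = 2 * (?s * (c * real (card Z)))"
      by simp
    also have "\<dots> \<le> 4 * ?s * real (card F)"
      using cZ by linarith
    also have "\<dots> < 4 * ?s * (?n\<^sup>2 / (4 * ?s) * (1 - 3 * \<delta>) * (1 - \<epsilon>)\<^sup>2)"
      using few s F(3) by (intro mult_strict_left_mono) auto
    also have "\<dots> = (1 - 3 * \<delta>) * ((1 - \<epsilon>) * ?n)\<^sup>2"
      using s by (simp add: power_mult_distrib)
    \<comment> \<open>The two losses sum to 9/4 + 1/8 = 19/8 < 3, which closes the circle of
      inequalities with one strict step.\<close>
    also have "\<dots> \<le> (1 - 9 / 4 * \<delta>) * (1 - \<delta> / 8) * ((1 - \<epsilon>) * ?n)\<^sup>2"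
    proof (rule mult_right_mono)
      have "0 \<le> \<delta> * \<delta>" by simp
      then show "1 - 3 * \<delta> \<le> (1 - 9 / 4 * \<delta>) * (1 - \<delta> / 8)"
        using \<delta> by (simp add: algebra_simps)
    qed simp
    finally show False
      by simp
  qed
  then obtain I where I: "I \<subseteq> \<B>" "card I = Suc s" "\<forall>X\<in>I. \<forall>Y\<in>I. X \<noteq> Y \<longrightarrow> \<not> R X Y"
    using independent_set_Turan[of \<B> R s] b(1) R_sym by (auto simp: R_def)
  have "\<exists>W. configuration V E' \<epsilon> (Suc s) L \<delta> W"
  proof (rule configuration_of_blocks)
    show "disjoint I"
      using b(2) I(1) by (auto simp: disjoint_def)
    show "\<Union>I \<subseteq> V"
      using b(3) I(1) by blast
    show "eps_regular E' \<epsilon> X Y \<and> density E' X Y \<in> {\<delta><..<1 - \<delta>}" if "X \<in> I" "Y \<in> I" "X \<noteq> Y" for X Y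
      using I(3) that unfolding R_def by blast
  qed (use I b in auto)
  then show ?thesis
    by (simp add: E'_def)
qed

theorem theorem2p6:
  shows "\<exists>M :: real \<Rightarrow> real. \<forall>\<epsilon>>0. M \<epsilon> > 0 \<and>
    (\<forall>(r::nat) (\<delta>::real).
       r \<ge> 2 \<longrightarrow> 0 < \<delta> \<longrightarrow> \<delta> < 1 \<longrightarrow> \<epsilon> < \<delta> / (16 * real r - 16) \<longrightarrow>
       (\<forall>\<^sub>F n in sequentially.
          \<exists>(V :: nat set) E. simple_graph V E \<and> card V = n \<and>
            (\<forall>D A. D \<subseteq> E \<longrightarrow> A \<subseteq> [V]\<^bsup>2\<^esup> - E \<longrightarrow>
               real (card D + card A)
                 < (real n)\<^sup>2 / (4 * (real r - 1)) * (1 - 3 * \<delta>) * (1 - \<epsilon>)\<^sup>2 \<longrightarrow>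
               (\<exists>L W. configuration V ((E - D) \<union> A) \<epsilon> r L \<delta> W \<and>
                      real L \<ge> real n * (1 - \<epsilon>) / M \<epsilon>))))"
proof -
  \<comment> \<open>\<open>M\<close> is chosen as a function of \<epsilon> alone, before
    \<open>r\<close> and \<delta> appear. For \<epsilon> > 1/2 the value 1 serves as a
    default.\<close>
  have "\<exists>M>0. \<epsilon> \<le> 1 / 2 \<longrightarrow> (\<forall>(V :: nat set) E. finite V \<longrightarrow> real (card V) \<ge> M \<longrightarrow>
      (\<exists>L \<B>. regular_blocks V E \<epsilon> L \<B> \<and> real L \<ge> real (card V) / M))" if "\<epsilon> > 0" for \<epsilon> :: real
    using regularity_lemma[OF that, where 'a = nat] zero_less_one by blast
  then obtain M :: "real \<Rightarrow> real" where M: "\<And>\<epsilon>. \<epsilon> > 0 \<Longrightarrow> M \<epsilon> > 0"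
    and reg: "\<And>\<epsilon> (V :: nat set) E. \<epsilon> > 0 \<Longrightarrow> \<epsilon> \<le> 1 / 2 \<Longrightarrow> finite V \<Longrightarrow> real (card V) \<ge> M \<epsilon> \<Longrightarrow>
      \<exists>L \<B>. regular_blocks V E \<epsilon> L \<B> \<and> real L \<ge> real (card V) / M \<epsilon>"
    by metis
  show ?thesis
  proof (intro exI[of _ M] allI impI conjI M)
    fix \<epsilon> \<delta> :: real and r :: nat
    assume \<epsilon>: "\<epsilon> > 0" and r: "r \<ge> 2" and \<delta>: "0 < \<delta>" "\<delta> < 1" and \<epsilon>\<delta>: "\<epsilon> < \<delta> / (16 * real r - 16)"
    define s where "s = r - 1"
    have s: "r = Suc s" "s > 0" "real s = real r - 1" "16 * real s = 16 * real r - 16"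
      using r by (auto simp: s_def of_nat_diff)
    have "\<delta> / (16 * real r - 16) \<le> \<delta> / 16"
      using r \<delta> by (intro divide_left_mono) auto
    then have \<epsilon>2: "\<epsilon> < 1 / 2"
      using \<epsilon>\<delta> \<delta> by linarith
    have Mpos: "M \<epsilon> > 0"
      using M \<epsilon> by blast
    \<comment> \<open>Only this threshold depends on \<delta>: its last entry turns L \<ge> n/M into
      n \<le> (\<delta>L/8)^2, the size condition of
      \<open>configuration_after_edits\<close>.\<close>
    have "\<forall>\<^sub>F n in sequentially. real n \<ge> max 1 (max (M \<epsilon>) ((8 * M \<epsilon> / \<delta>)\<^sup>2))"
      using filterlim_real_sequentially by (simp only: filterlim_at_top)
    then show "\<forall>\<^sub>F n in sequentially.
          \<exists>(V :: nat set) E. simple_graph V E \<and> card V = n \<and>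
            (\<forall>D A. D \<subseteq> E \<longrightarrow> A \<subseteq> [V]\<^bsup>2\<^esup> - E \<longrightarrow>
               real (card D + card A)
                 < (real n)\<^sup>2 / (4 * (real r - 1)) * (1 - 3 * \<delta>) * (1 - \<epsilon>)\<^sup>2 \<longrightarrow>
               (\<exists>L W. configuration V ((E - D) \<union> A) \<epsilon> r L \<delta> W \<and>
                      real L \<ge> real n * (1 - \<epsilon>) / M \<epsilon>))"
    proof eventually_elim
      case (elim n)
      then have n: "real n \<ge> 1" "real n \<ge> M \<epsilon>" "real n \<ge> (8 * M \<epsilon> / \<delta>)\<^sup>2"
        by auto
      then have "n > 0" by simp
      then obtain E where E: "E \<subseteq> [{..<n}]\<^bsup>2\<^esup>" and qr: "\<And>X Y. X \<subseteq> {..<n} \<Longrightarrow> Y \<subseteq> {..<n} \<Longrightarrow> X \<inter> Y = {} \<Longrightarrow>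
          (real (card (edges_between E X Y)) - real (card X) * real (card Y) / 2)\<^sup>2
            \<le> real n * (real (card X) * real (card Y))"
        using quasirandom_graph_exists[of n] by metis
      have "\<exists>L W. configuration {..<n} ((E - D) \<union> A) \<epsilon> r L \<delta> W \<and> real L \<ge> real n * (1 - \<epsilon>) / M \<epsilon>"
        if D: "D \<subseteq> E" and A: "A \<subseteq> [{..<n}]\<^bsup>2\<^esup> - E"
          and few: "real (card D + card A) < (real n)\<^sup>2 / (4 * (real r - 1)) * (1 - 3 * \<delta>) * (1 - \<epsilon>)\<^sup>2" for D A
      proof -
        obtain L \<B> where \<B>: "regular_blocks {..<n} ((E - D) \<union> A) \<epsilon> L \<B>" and L: "real L \<ge> real n / M \<epsilon>"
          using reg[of \<epsilon> "{..<n}" "(E - D) \<union> A"] \<epsilon> \<epsilon>2 n(2) by auto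
        have "real n * 1 \<le> real n * (real n * (\<delta> / (8 * M \<epsilon>))\<^sup>2)"
        proof (rule mult_left_mono)
          have "(8 * M \<epsilon> / \<delta>)\<^sup>2 * (\<delta> / (8 * M \<epsilon>))\<^sup>2 \<le> real n * (\<delta> / (8 * M \<epsilon>))\<^sup>2"
            using n(3) by (rule mult_right_mono) simp
          then show "1 \<le> real n * (\<delta> / (8 * M \<epsilon>))\<^sup>2"
            using \<delta> Mpos by (simp flip: power_mult_distrib)
        qed simp
        also have "\<dots> = (\<delta> / 8 * (real n / M \<epsilon>))\<^sup>2"
          by (simp add: power2_eq_square)
        also have "\<dots> \<le> (\<delta> / 8 * real L)\<^sup>2"
          using L \<delta> Mpos by (intro power_mono mult_left_mono) auto
        finally have "real (card {..<n}) \<le> (\<delta> / 8 * real L)\<^sup>2"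
          by simp
        moreover have "real (card D + card A) < (real (card {..<n}))\<^sup>2 / (4 * real s) * (1 - 3 * \<delta>) * (1 - \<epsilon>)\<^sup>2"
          using few by (simp only: s(3) card_lessThan)
        ultimately have "\<exists>W. configuration {..<n} ((E - D) \<union> A) \<epsilon> (Suc s) L \<delta> W"
          using E qr s(2,4) \<delta>(1) \<epsilon> \<epsilon>2 \<epsilon>\<delta> D A \<B>
          by (intro configuration_after_edits[of "{..<n}" E]) simp_all
        moreover have "real n * (1 - \<epsilon>) / M \<epsilon> \<le> real n / M \<epsilon>"
          using \<epsilon> Mpos by (intro divide_right_mono) (auto simp: mult_left_le)
        ultimately show ?thesis
          using L s(1) by (meson order_trans)
      qed
      then show ?case
        using E by (intro exI[of _ "{..<n}"] exI[of _ E]) (auto simp: simple_graph_def)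
    qed
  qed
qed

end
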